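(* Let $U$ be an $n\times n$ unitary matrix for which $e_1=[1,0,\ldots,0]^T$ is cyclic. Then $U$ can be reduced to CMV shape by successive conjugations with Householder reflections; that is, there are finitely many Householder reflections $R_1,\ldots,R_N$ such that $R_N\cdots R_1\,U\,R_1^\dagger\cdots R_N^\dagger$ has CMV shape. Moreover, this can be done without altering the spectral measure associated to $e_1$.
   Context: $\dagger$ denotes conjugate transpose. A Householder reflection here means an $n\times n$ unitary matrix of the form $D R_0$, where $R_0$ is either the identity or $R_0=I-2vv^\dagger/\|v\|^2$ for some nonzero $v\in\mathbb{C}^n$, and $D=\mathrm{diag}(1,\ldots,1,e^{i\theta},1,\ldots,1)$ is a diagonal unitary matrix with at most one diagonal entry different from $1$. A vector $e$ is cyclic for $U$ if $\{U^k e: k\ge 0\}$ spans $\mathbb{C}^n$. The spectral measure of a unitary $V$ associated to $e_1$ is the probability measure $d\mu$ on the unit circle with $\langle e_1| f(V)e_1\rangle=\int f\,d\mu$ for all functions $f$ on the circle. An $n\times n$ matrix $B$ has CMV shape if (a) for each $j\ge 0$ and each row index $k\in\{2j+1,2j+2\}$ one has $B_{kl}=0$ unless $2j\le l\le 2j+3$; and (b) the entries $B_{2,1}$, $B_{2j-1,2j+1}$ and $B_{2j+2,2j}$ ($j\ge1$), whenever the indices lie in $\{1,\dots,n\}$, are (real and) strictly positive. *)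

theory Defs
  imports
    "HOL-Probability.Probability"
    "Jordan_Normal_Form.Schur_Decomposition"
begin

no_notation vec_nth (infixl \<open>$\<close> 90)

definition unitary_mat :: "nat \<Rightarrow> complex mat \<Rightarrow> bool" where
  "unitary_mat n A \<longleftrightarrow>
     A \<in> carrier_mat n n \<and> A * mat_adjoint A = 1\<^sub>m n \<and> mat_adjoint A * A = 1\<^sub>m n"

(* I - 2 v v^dagger / |v|^2, where |v|^2 is the complex number v \<bullet>c v. *)
definition reflection_mat :: "nat \<Rightarrow> complex Matrix.vec \<Rightarrow> complex mat" where
  "reflection_mat n v =
     1\<^sub>m n - (2 / (v \<bullet>c v)) \<cdot>\<^sub>m Matrix.mat n n (\<lambda>(i, j). v $ i * cnj (v $ j))"

definition phase_mat :: "nat \<Rightarrow> nat \<Rightarrow> real \<Rightarrow> complex mat" where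
  "phase_mat n k \<theta> = mat_diag n (\<lambda>i. if i = k then cis \<theta> else 1)"

definition householder :: "nat \<Rightarrow> complex mat \<Rightarrow> bool" where
  "householder n R \<longleftrightarrow> unitary_mat n R \<and>
     (\<exists>k<n. \<exists>\<theta> R0. R = phase_mat n k \<theta> * R0 \<and>
        (R0 = 1\<^sub>m n \<or> (\<exists>v \<in> carrier_vec n. v \<noteq> 0\<^sub>v n \<and> R0 = reflection_mat n v)))"

definition cyclic_vec :: "nat \<Rightarrow> complex mat \<Rightarrow> complex Matrix.vec \<Rightarrow> bool" where
  "cyclic_vec n U e \<longleftrightarrow>
     LinearCombinations.module.span class_ring (module_vec TYPE(complex) n)
       (range (\<lambda>k. (U ^\<^sub>m k) *\<^sub>v e)) = carrier_vec n"

(* F = f(V) in the sense of the spectral theorem for unitary V; F does not depend on the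
   diagonalisation that is chosen (fun_calc_unique below). *)
definition fun_calc ::
    "nat \<Rightarrow> (complex \<Rightarrow> complex) \<Rightarrow> complex mat \<Rightarrow> complex mat \<Rightarrow> bool" where
  "fun_calc n f V F \<longleftrightarrow>
     (\<exists>W d. unitary_mat n W \<and>
        V = W * mat_diag n d * mat_adjoint W \<and>
        F = W * mat_diag n (\<lambda>i. f (d i)) * mat_adjoint W)"

lemma mat_adjoint_carrier: "A \<in> carrier_mat m n \<Longrightarrow> mat_adjoint A \<in> carrier_mat n m"
  unfolding mat_adjoint_def carrier_mat_def by simp

lemma fun_calc_unique:
  assumes "fun_calc n f V F" "fun_calc n f V G"
  shows "F = G"
proof -
  obtain W d where W: "unitary_mat n W" and V1: "V = W * mat_diag n d * mat_adjoint W"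
    and F: "F = W * mat_diag n (\<lambda>i. f (d i)) * mat_adjoint W"
    using assms(1) unfolding fun_calc_def by (elim exE conjE) (rule that)
  obtain X c where X: "unitary_mat n X" and V2: "V = X * mat_diag n c * mat_adjoint X"
    and G: "G = X * mat_diag n (\<lambda>i. f (c i)) * mat_adjoint X"
    using assms(2) unfolding fun_calc_def by (elim exE conjE) (rule that)
  have Wc: "W \<in> carrier_mat n n" and W1: "W * mat_adjoint W = 1\<^sub>m n" "mat_adjoint W * W = 1\<^sub>m n"
    using W unfolding unitary_mat_def by simp_all
  have Xc: "X \<in> carrier_mat n n" and X1: "X * mat_adjoint X = 1\<^sub>m n" "mat_adjoint X * X = 1\<^sub>m n"
    using X unfolding unitary_mat_def by simp_all
  have Wa: "mat_adjoint W \<in> carrier_mat n n" and Xa: "mat_adjoint X \<in> carrier_mat n n"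
    by (simp_all add: mat_adjoint_carrier Wc Xc)
  note as = assoc_mult_mat[of _ n n _ n _ n]
  note mc = mult_carrier_mat[of _ n n _ n]
  define M where "M = mat_adjoint X * W"
  have Mc: "M \<in> carrier_mat n n" unfolding M_def using Xa Wc by auto
  have XM: "X * M = W"
  proof -
    have "X * M = (X * mat_adjoint X) * W" unfolding M_def using Xc Xa Wc by (simp add: as)
    then show ?thesis using X1 Wc by simp
  qed
  have MW: "M * mat_adjoint W = mat_adjoint X"
  proof -
    have "M * mat_adjoint W = mat_adjoint X * (W * mat_adjoint W)"
      unfolding M_def using Wa Xa Wc by (simp add: as)
    then show ?thesis using W1 Xa by simp
  qed
  have VW: "V * W = W * mat_diag n d"
  proof -
    have "V * W = W * mat_diag n d * (mat_adjoint W * W)"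
      unfolding V1 by (rule as) (simp_all add: mc Wc Wa)
    also have "\<dots> = W * mat_diag n d"
      unfolding W1 by (rule right_mult_one_mat[of _ n]) (simp_all add: mc Wc)
    finally show ?thesis .
  qed
  have XV: "mat_adjoint X * V = mat_diag n c * mat_adjoint X"
  proof -
    have "mat_adjoint X * V = (mat_adjoint X * X) * (mat_diag n c * mat_adjoint X)"
      unfolding V2 using Xc Xa by (simp add: as[of "mat_adjoint X"] as[of X] mc)
    also have "\<dots> = mat_diag n c * mat_adjoint X"
      unfolding X1 by (rule left_mult_one_mat[of _ n n]) (simp_all add: mc Xa)
    finally show ?thesis .
  qed
  have Vc: "V \<in> carrier_mat n n" unfolding V1 by (simp add: mc Wc Wa)
  have comm: "M * mat_diag n d = mat_diag n c * M"
  proof -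
    have "M * mat_diag n d = mat_adjoint X * (V * W)"
      unfolding VW M_def using Xa Wc by (simp add: as)
    also have "\<dots> = (mat_adjoint X * V) * W" using Xa Vc Wc by (simp add: as)
    also have "\<dots> = mat_diag n c * M" unfolding XV M_def using Xa Wc by (simp add: as)
    finally show ?thesis .
  qed
  have ent: "M $$ (i, j) * f (d j) = f (c i) * M $$ (i, j)" if "i < n" "j < n" for i j
  proof -
    have "(M * mat_diag n d) $$ (i, j) = (mat_diag n c * M) $$ (i, j)" using comm by simp
    then have "M $$ (i, j) * d j = c i * M $$ (i, j)"
      using that unfolding mat_diag_mult_right[OF Mc] mat_diag_mult_left[OF Mc] by simp
    then have "M $$ (i, j) = 0 \<or> d j = c i"
      by (metis mult.commute mult_left_cancel)
    then show ?thesis by (metis mult.commute mult_zero_left)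
  qed
  have fcomm: "M * mat_diag n (\<lambda>i. f (d i)) = mat_diag n (\<lambda>i. f (c i)) * M"
    unfolding mat_diag_mult_right[OF Mc] mat_diag_mult_left[OF Mc]
    by (rule cong_mat) (simp_all add: ent)
  have "F = (X * (M * mat_diag n (\<lambda>i. f (d i)))) * mat_adjoint W"
    unfolding F using XM Xc Mc by (simp add: as[of X M, symmetric])
  also have "\<dots> = X * mat_diag n (\<lambda>i. f (c i)) * (M * mat_adjoint W)"
    unfolding fcomm using Xc Mc Wa
    by (simp add: as[of X _ M, symmetric] as[of _ M "mat_adjoint W"] mc)
  finally show ?thesis unfolding MW G .
qed

(* The inner product <e | f(V) e>, conjugate-linear in the first argument, is (f(V) e) \<bullet>c e,
   since \<bullet>c is conjugate-linear in the second. *)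
definition spectral_measure ::
    "nat \<Rightarrow> complex mat \<Rightarrow> complex Matrix.vec \<Rightarrow> complex measure \<Rightarrow> bool" where
  "spectral_measure n V e \<mu> \<longleftrightarrow>
     prob_space \<mu> \<and> space \<mu> = sphere 0 1 \<and>
     sets \<mu> = sets (restrict_space borel (sphere 0 1)) \<and>
     (\<forall>f \<in> borel_measurable \<mu>.
        \<exists>F. fun_calc n f V F \<and> integrable \<mu> f \<and> (F *\<^sub>v e) \<bullet>c e = (LINT z|\<mu>. f z))"

lemma spectral_measure_unique:
  assumes M: "spectral_measure n V e \<mu>" and N: "spectral_measure n V e \<nu>"
  shows "\<mu> = \<nu>"
proof (rule measure_eqI)
  show sets: "sets \<mu> = sets \<nu>" using M N unfolding spectral_measure_def by simp
  interpret M: prob_space \<mu> using M unfolding spectral_measure_def by simp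
  interpret N: prob_space \<nu> using N unfolding spectral_measure_def by simp
  fix A assume A: "A \<in> sets \<mu>"
  then have B: "A \<in> sets \<nu>" using sets by simp
  let ?f = "\<lambda>z. indicator A z :: complex"
  have m: "?f \<in> borel_measurable \<mu>" "?f \<in> borel_measurable \<nu>"
    using A B by auto
  obtain F where F: "fun_calc n ?f V F" "(F *\<^sub>v e) \<bullet>c e = (LINT z|\<mu>. ?f z)"
    using M m(1) unfolding spectral_measure_def by blast
  obtain G where G: "fun_calc n ?f V G" "(G *\<^sub>v e) \<bullet>c e = (LINT z|\<nu>. ?f z)"
    using N m(2) unfolding spectral_measure_def by blast
  have "(LINT z|\<mu>. ?f z) = (LINT z|\<nu>. ?f z)"
    using F(2) G(2) fun_calc_unique[OF F(1) G(1)] by simp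
  moreover have "(LINT z|\<mu>. ?f z) = of_real (measure \<mu> A)"
  proof -
    have "(LINT z|\<mu>. ?f z) = (LINT z|\<mu>. complex_of_real (indicator A z))"
      by (rule Bochner_Integration.integral_cong) (auto simp: indicator_def)
    also have "\<dots> = of_real (LINT z|\<mu>. indicator A z)"
      by (rule integral_complex_of_real)
    also have "(LINT z|\<mu>. indicator A z) = measure \<mu> A"
      using sets.sets_into_space[OF A] by (simp add: Int_absorb2)
    finally show ?thesis .
  qed
  moreover have "(LINT z|\<nu>. ?f z) = of_real (measure \<nu> A)"
  proof -
    have "(LINT z|\<nu>. ?f z) = (LINT z|\<nu>. complex_of_real (indicator A z))"
      by (rule Bochner_Integration.integral_cong) (auto simp: indicator_def)
    also have "\<dots> = of_real (LINT z|\<nu>. indicator A z)"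
      by (rule integral_complex_of_real)
    also have "(LINT z|\<nu>. indicator A z) = measure \<nu> A"
      using sets.sets_into_space[OF B] by (simp add: Int_absorb2)
    finally show ?thesis .
  qed
  ultimately have "measure \<mu> A = measure \<nu> A" by simp
  then show "emeasure \<mu> A = emeasure \<nu> A"
    by (simp add: M.emeasure_eq_measure N.emeasure_eq_measure)
qed

(* Matrix entries in the mathematical numbering 1,...,n. *)
abbreviation entry :: "complex mat \<Rightarrow> nat \<Rightarrow> nat \<Rightarrow> complex" where
  "entry B k l \<equiv> B $$ (k - 1, l - 1)"

definition pos_real :: "complex \<Rightarrow> bool" where
  "pos_real z \<longleftrightarrow> z \<in> \<real> \<and> Re z > 0"

definition CMV_shape :: "nat \<Rightarrow> complex mat \<Rightarrow> bool" where
  "CMV_shape n B \<longleftrightarrow> B \<in> carrier_mat n n \<and>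
     (\<forall>j. \<forall>k \<in> {2*j+1, 2*j+2} \<inter> {1..n}. \<forall>l \<in> {1..n}.
        \<not> (2*j \<le> l \<and> l \<le> 2*j+3) \<longrightarrow> entry B k l = 0) \<and>
     (2 \<le> n \<longrightarrow> pos_real (entry B 2 1)) \<and>
     (\<forall>j\<ge>1. 2*j+1 \<le> n \<longrightarrow> pos_real (entry B (2*j-1) (2*j+1))) \<and>
     (\<forall>j\<ge>1. 2*j+2 \<le> n \<longrightarrow> pos_real (entry B (2*j+2) (2*j)))"

(* For Rs = [R_1, ..., R_N] this is R_N ... R_1 U R_1^dagger ... R_N^dagger. *)
definition conj_by :: "complex mat list \<Rightarrow> complex mat \<Rightarrow> complex mat" where
  "conj_by Rs U = fold (\<lambda>R A. R * A * mat_adjoint R) Rs U"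

end

(* Apply Householder reflections that fix the leading coordinates 0, ..., m - 1 and send the part
   below row m - 1 of a column of the current matrix A, or of its adjoint, to a positive multiple of
   e_m. Columns and rows alternate: column 0, row 0, column 1, row 2, column 3, row 4, ...
   Orthogonality of the columns (rows) of A then forces the remaining zeros of the CMV shape. If the
   vector to be reflected vanishes, the same orthogonality makes the span of e_0, ..., e_(m-1)
   invariant, against cyclicity. All reflections fix e_0, so in a diagonalisation the weights
   |<w_i | e_0>|^2 of the spectral measure are unchanged. *)
theory Submission
  imports Defs "Jordan_Normal_Form.Spectral_Radius"
begin

section \<open>Unitary matrices by entries\<close>

text \<open>Only the pivots (the positive last entries of the treated columns) have to be carried
  through the induction. A column supported in coordinates below m is fixed by the reflection of
  step m and by all later ones, so its pivot survives; the forced zeros are recomputed from the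
  unitarity of the current matrix at every stage. Row steps are column steps for the adjoint, and
  conjugation by R commutes with adjoints, so \<open>par\<close> lets one argument serve both.

  The alternation causes one asymmetry: if the vector to be reflected vanishes at an even step, it
  is the adjoint that visibly leaves the span of the first m coordinate vectors invariant, whereas
  cyclicity concerns U. In finite dimension a unitary matrix with one vanishing off-diagonal block
  has the other one vanishing too.

  The diagonal factor of a Householder reflection is what makes the pivots positive: a complex
  reflection carries w only to vectors whose inner product with w is real, and the phase left over
  is removed afterwards.

  The spectral measure is tested against all Borel functions, so an actual diagonalisation is
  required; it is built by deflation with the same reflections.\<close>

lemma index_mult_mat_vec_sum:
  "A \<in> carrier_mat nr n \<Longrightarrow> x \<in> carrier_vec n \<Longrightarrow> i < nr \<Longrightarrow>
    (A *\<^sub>v x) $ i = (\<Sum>j<n. A $$ (i, j) * x $ j)"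
  by (simp add: scalar_prod_def atLeast0LessThan)

lemma index_mult_mat_sum:
  "A \<in> carrier_mat nr n \<Longrightarrow> B \<in> carrier_mat n nc \<Longrightarrow> i < nr \<Longrightarrow> j < nc \<Longrightarrow>
    (A * B) $$ (i, j) = (\<Sum>k<n. A $$ (i, k) * B $$ (k, j))"
  by (simp add: scalar_prod_def atLeast0LessThan)

lemma cscalar_prod_sum:
  "y \<in> carrier_vec n \<Longrightarrow> x \<bullet>c y = (\<Sum>i<n. x $ i * cnj (y $ i))"
  by (simp add: scalar_prod_def atLeast0LessThan)

lemma cscalar_prod_self:
  fixes v :: "complex Matrix.vec"
  shows "v \<in> carrier_vec n \<Longrightarrow> v \<bullet>c v = of_real (\<Sum>i<n. (cmod (v $ i))\<^sup>2)"
  unfolding cscalar_prod_sum of_real_sum by (rule sum.cong) (simp_all only: complex_norm_square)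

lemma index_mat_adjoint:
  fixes A :: "complex mat"
  shows "A \<in> carrier_mat m n \<Longrightarrow> i < n \<Longrightarrow> j < m \<Longrightarrow> mat_adjoint A $$ (i, j) = cnj (A $$ (j, i))"
  unfolding mat_adjoint_def by (simp add: mat_of_rows_index)

lemma mat_adjoint_mat_adjoint:
  fixes A :: "complex mat"
  assumes "A \<in> carrier_mat m n"
  shows "mat_adjoint (mat_adjoint A) = A"
proof (rule eq_matI)
  show "dim_row (mat_adjoint (mat_adjoint A)) = dim_row A"
    "dim_col (mat_adjoint (mat_adjoint A)) = dim_col A"
    using mat_adjoint_carrier[OF mat_adjoint_carrier[OF assms]] assms by auto
  fix i j assume "i < dim_row A" "j < dim_col A"
  then show "mat_adjoint (mat_adjoint A) $$ (i, j) = A $$ (i, j)"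
    using assms mat_adjoint_carrier[OF assms] by (simp add: index_mat_adjoint)
qed

lemma mat_adjoint_mult:
  fixes A B :: "complex mat"
  assumes A: "A \<in> carrier_mat m k" and B: "B \<in> carrier_mat k n"
  shows "mat_adjoint (A * B) = mat_adjoint B * mat_adjoint A"
proof (rule eq_matI)
  note AB = mult_carrier_mat[OF A B]
  note A' = mat_adjoint_carrier[OF A] and B' = mat_adjoint_carrier[OF B]
  show "dim_row (mat_adjoint (A * B)) = dim_row (mat_adjoint B * mat_adjoint A)"
    "dim_col (mat_adjoint (A * B)) = dim_col (mat_adjoint B * mat_adjoint A)"
    using mat_adjoint_carrier[OF AB] A' B' by auto
  fix i j assume "i < dim_row (mat_adjoint B * mat_adjoint A)"
    "j < dim_col (mat_adjoint B * mat_adjoint A)"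
  then have ij: "i < n" "j < m" using A' B' by auto
  have "mat_adjoint (A * B) $$ (i, j) = (\<Sum>l<k. cnj (A $$ (j, l)) * cnj (B $$ (l, i)))"
    using ij by (simp add: index_mat_adjoint[OF AB] index_mult_mat_sum[OF A B] del: index_mult_mat(1))
  also have "\<dots> = (\<Sum>l<k. mat_adjoint B $$ (i, l) * mat_adjoint A $$ (l, j))"
    by (rule sum.cong) (use ij A B in \<open>simp_all add: index_mat_adjoint\<close>)
  also have "\<dots> = (mat_adjoint B * mat_adjoint A) $$ (i, j)"
    using index_mult_mat_sum[OF B' A'] ij by simp
  finally show "mat_adjoint (A * B) $$ (i, j) = (mat_adjoint B * mat_adjoint A) $$ (i, j)" .
qed

lemma unitary_matD:
  assumes "unitary_mat n A"
  shows "A \<in> carrier_mat n n" "mat_adjoint A \<in> carrier_mat n n"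
    "A * mat_adjoint A = 1\<^sub>m n" "mat_adjoint A * A = 1\<^sub>m n"
  using assms mat_adjoint_carrier unfolding unitary_mat_def by auto

lemma unitary_mat_adjoint: "unitary_mat n A \<Longrightarrow> unitary_mat n (mat_adjoint A)"
  unfolding unitary_mat_def
  by (elim conjE, intro conjI) (simp_all only: mat_adjoint_carrier mat_adjoint_mat_adjoint)

lemma unitary_mat_one: "unitary_mat n (1\<^sub>m n)"
proof -
  have "mat_adjoint (1\<^sub>m n) = (1\<^sub>m n :: complex mat)"
    by (rule eq_matI) (use mat_adjoint_carrier[of "1\<^sub>m n :: complex mat" n n] in
        \<open>auto simp: index_mat_adjoint[of _ n n]\<close>)
  then show ?thesis unfolding unitary_mat_def by simp
qed

lemma unitary_mat_mult:
  assumes "unitary_mat n A" "unitary_mat n B"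
  shows "unitary_mat n (A * B)"
proof -
  note A = unitary_matD[OF assms(1)] and B = unitary_matD[OF assms(2)]
  note as = assoc_mult_mat[of _ n n _ n _ n]
  have "A * B * (mat_adjoint B * mat_adjoint A) = A * (B * mat_adjoint B) * mat_adjoint A"
    using A(1,2) B(1,2) by (simp add: as mult_carrier_mat[of _ n n _ n])
  also have "\<dots> = 1\<^sub>m n" unfolding B(3) right_mult_one_mat[OF A(1)] by (rule A(3))
  finally have 1: "A * B * (mat_adjoint B * mat_adjoint A) = 1\<^sub>m n" .
  have "mat_adjoint B * mat_adjoint A * (A * B) = mat_adjoint B * (mat_adjoint A * A) * B"
    using A(1,2) B(1,2) by (simp add: as mult_carrier_mat[of _ n n _ n])
  also have "\<dots> = 1\<^sub>m n" unfolding A(4) right_mult_one_mat[OF B(2)] by (rule B(4))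
  finally have 2: "mat_adjoint B * mat_adjoint A * (A * B) = 1\<^sub>m n" .
  show ?thesis
    unfolding unitary_mat_def mat_adjoint_mult[OF A(1) B(1)] using A(1) B(1) 1 2 by auto
qed

section \<open>Orthogonality relations and the zeros they force\<close>

lemma unitary_mat_row_inner:
  assumes "unitary_mat n A" "i < n" "j < n"
  shows "(\<Sum>k<n. A $$ (i, k) * cnj (A $$ (j, k))) = (if i = j then 1 else 0)"
proof -
  note A = unitary_matD[OF assms(1)]
  have "(\<Sum>k<n. A $$ (i, k) * cnj (A $$ (j, k))) = (\<Sum>k<n. A $$ (i, k) * mat_adjoint A $$ (k, j))"
    by (rule sum.cong) (use assms A in \<open>simp_all add: index_mat_adjoint\<close>)
  also have "\<dots> = (A * mat_adjoint A) $$ (i, j)"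
    using index_mult_mat_sum[OF A(1,2)] assms by simp
  finally show ?thesis using A(3) assms by simp
qed

lemma unitary_mat_col_inner:
  assumes "unitary_mat n A" "i < n" "j < n"
  shows "(\<Sum>k<n. cnj (A $$ (k, i)) * A $$ (k, j)) = (if i = j then 1 else 0)"
proof -
  have "(\<Sum>k<n. cnj (A $$ (k, i)) * A $$ (k, j)) =
      (\<Sum>k<n. mat_adjoint A $$ (i, k) * cnj (mat_adjoint A $$ (j, k)))"
    by (rule sum.cong) (use assms unitary_matD[OF assms(1)] in \<open>simp_all add: index_mat_adjoint\<close>)
  also have "\<dots> = (if i = j then 1 else 0)"
    by (rule unitary_mat_row_inner[OF unitary_mat_adjoint[OF assms(1)] assms(2,3)])
  finally show ?thesis .
qed

text \<open>Only row \<open>i\<close> contributes to the inner product of the orthogonal columns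
  \<open>j\<close> and \<open>c\<close>, so a product of two entries vanishes while one factor does
  not. The zeros of the CMV shape that no reflection creates come from here.\<close>

lemma unitary_mat_pivot:
  assumes A: "unitary_mat n A" and i: "i < n" and j: "j < n" and c: "c < n"
    and "j \<noteq> c" and nz: "A $$ (i, j) \<noteq> 0"
    and z: "\<And>k. k < n \<Longrightarrow> k \<noteq> i \<Longrightarrow> A $$ (k, j) = 0 \<or> A $$ (k, c) = 0"
  shows "A $$ (i, c) = 0"
proof -
  have "0 = (\<Sum>k<n. cnj (A $$ (k, j)) * A $$ (k, c))"
    unfolding unitary_mat_col_inner[OF A j c] using \<open>j \<noteq> c\<close> by simp
  also have "\<dots> = (\<Sum>k<n. if k = i then cnj (A $$ (i, j)) * A $$ (i, c) else 0)"
  proof (rule sum.cong[OF refl])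
    fix k assume "k \<in> {..<n}"
    then show "cnj (A $$ (k, j)) * A $$ (k, c) =
        (if k = i then cnj (A $$ (i, j)) * A $$ (i, c) else 0)"
      using z[of k] by (cases "k = i") auto
  qed
  also have "\<dots> = cnj (A $$ (i, j)) * A $$ (i, c)"
    using i by simp
  finally show ?thesis using nz by simp
qed

text \<open>The upper left block has orthonormal rows or columns, so counting its squared entries by
  rows and by columns leaves nothing for the off-diagonal block.\<close>

lemma unitary_mat_block:
  assumes A: "unitary_mat n A" and m: "m \<le> n"
    and z: "\<And>i k. i < m \<Longrightarrow> m \<le> k \<Longrightarrow> k < n \<Longrightarrow> A $$ (k, i) = 0"
    and i: "i < m" "m \<le> k" "k < n"
  shows "A $$ (i, k) = 0"
proof -
  define a where "a = (\<lambda>i k. (cmod (A $$ (i, k)))\<^sup>2)"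
  have row: "(\<Sum>k<n. a i k) = 1" if "i < n" for i
  proof -
    have "complex_of_real (\<Sum>k<n. a i k) = (\<Sum>k<n. A $$ (i, k) * cnj (A $$ (i, k)))"
      unfolding a_def of_real_sum by (rule sum.cong) (simp_all only: complex_norm_square)
    then show ?thesis using unitary_mat_row_inner[OF A that that] of_real_eq_1_iff by metis
  qed
  have col: "(\<Sum>k<n. a k i) = 1" if "i < n" for i
  proof -
    have "complex_of_real (\<Sum>k<n. a k i) = (\<Sum>k<n. cnj (A $$ (k, i)) * A $$ (k, i))"
      unfolding a_def of_real_sum by (rule sum.cong) (simp_all only: complex_norm_square mult.commute)
    then show ?thesis using unitary_mat_col_inner[OF A that that] of_real_eq_1_iff by metis
  qed
  have split: "{..<n} = {..<m} \<union> {m..<n}" using m by auto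
  have sp: "(\<Sum>k<n. f k) = (\<Sum>k<m. f k) + (\<Sum>k\<in>{m..<n}. f k)" for f :: "nat \<Rightarrow> real"
    unfolding split by (rule sum.union_disjoint) auto
  have "(\<Sum>i<m. \<Sum>k<m. a k i) = (\<Sum>i<m. \<Sum>k<n. a k i)"
    unfolding sp using z by (auto intro!: sum.cong sum.neutral simp: a_def)
  also have "\<dots> = m" using col m by simp
  finally have "(\<Sum>i<m. \<Sum>k<m. a i k) = m" by (subst sum.swap)
  moreover have "(\<Sum>i<m. (\<Sum>k<m. a i k) + (\<Sum>k\<in>{m..<n}. a i k)) = m"
    unfolding sp[symmetric] using row m by simp
  ultimately have "(\<Sum>i<m. \<Sum>k\<in>{m..<n}. a i k) = 0" by (simp add: sum.distrib)
  then have "\<forall>i<m. (\<Sum>k\<in>{m..<n}. a i k) = 0"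
    by (subst (asm) sum_nonneg_eq_0_iff) (auto simp: a_def intro!: sum_nonneg)
  then have "(\<Sum>k\<in>{m..<n}. a i k) = 0" using i by simp
  then have "a i k = 0"
    using i by (subst (asm) sum_nonneg_eq_0_iff) (auto simp: a_def)
  then show ?thesis by (simp add: a_def)
qed

section \<open>Householder reflections\<close>

lemma reflection_mat_carrier: "reflection_mat n v \<in> carrier_mat n n"
  unfolding reflection_mat_def by auto

lemma index_reflection_mat:
  "i < n \<Longrightarrow> j < n \<Longrightarrow>
    reflection_mat n v $$ (i, j) = (if i = j then 1 else 0) - 2 / (v \<bullet>c v) * (v $ i * cnj (v $ j))"
  by (simp add: reflection_mat_def)

lemma index_reflection_mat_mult_vec:
  fixes v x :: "complex Matrix.vec"
  assumes v: "v \<in> carrier_vec n" and x: "x \<in> carrier_vec n" and i: "i < n"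
  shows "(reflection_mat n v *\<^sub>v x) $ i = x $ i - 2 * (x \<bullet>c v) / (v \<bullet>c v) * v $ i"
proof -
  have "(reflection_mat n v *\<^sub>v x) $ i =
      (\<Sum>j<n. (if j = i then x $ i else 0) - 2 / (v \<bullet>c v) * v $ i * (x $ j * cnj (v $ j)))"
    unfolding index_mult_mat_vec_sum[OF reflection_mat_carrier x i]
  proof (rule sum.cong[OF refl])
    fix j assume "j \<in> {..<n}"
    then have e: "reflection_mat n v $$ (i, j) =
        (if i = j then 1 else 0) - 2 / (v \<bullet>c v) * (v $ i * cnj (v $ j))"
      using i by (simp only: index_reflection_mat lessThan_iff)
    show "reflection_mat n v $$ (i, j) * x $ j =
        (if j = i then x $ i else 0) - 2 / (v \<bullet>c v) * v $ i * (x $ j * cnj (v $ j))"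
      unfolding e by (simp add: left_diff_distrib del: conjugate_square_eq_0_vec)
  qed
  also have "\<dots> = x $ i - 2 / (v \<bullet>c v) * v $ i * (\<Sum>j<n. x $ j * cnj (v $ j))"
    unfolding sum_subtractf sum_distrib_left[symmetric] using i by simp
  finally show ?thesis by (simp add: cscalar_prod_sum[OF v])
qed

text \<open>The matrix is self-adjoint because \<open>v \<bullet>c v\<close> is real, so unitarity
  reduces to its being an involution.\<close>

lemma unitary_reflection_mat:
  assumes v: "v \<in> carrier_vec n" and nz: "v \<noteq> 0\<^sub>v n"
  shows "unitary_mat n (reflection_mat n v)"
proof -
  let ?R = "reflection_mat n v"
  note c = reflection_mat_carrier[of n v]
  define s where "s = v \<bullet>c v"
  have s: "s \<noteq> 0" using nz v unfolding s_def by simp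
  have cs: "cnj s = s" unfolding s_def cscalar_prod_self[OF v] by simp
  have adj: "mat_adjoint ?R = ?R"
  proof (rule eq_matI)
    show "dim_row (mat_adjoint ?R) = dim_row ?R" "dim_col (mat_adjoint ?R) = dim_col ?R"
      using c mat_adjoint_carrier[OF c] by auto
    fix i j assume "i < dim_row ?R" "j < dim_col ?R"
    then have ij: "i < n" "j < n" using c by auto
    show "mat_adjoint ?R $$ (i, j) = ?R $$ (i, j)"
      unfolding index_mat_adjoint[OF c ij] index_reflection_mat[OF ij] index_reflection_mat[OF ij(2,1)]
        s_def[symmetric] using cs by (auto simp: mult.commute)
  qed
  have "?R * ?R = 1\<^sub>m n"
  proof (rule eq_matI)
    fix i j assume "i < dim_row (1\<^sub>m n)" "j < dim_col (1\<^sub>m n)"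
    then have ij: "i < n" "j < n" by auto
    \<comment> \<open>The product of two entries is expanded into four terms. Summing the last one
      over \<open>k\<close> yields a factor \<open>s\<close>, which makes it cancel the two middle
      ones.\<close>
    have "(?R * ?R) $$ (i, j) = (\<Sum>k<n. (if k = i then if i = j then 1 else 0 else 0)
        - (if k = i then 2 / s * (v $ i * cnj (v $ j)) else 0)
        - (if k = j then 2 / s * (v $ i * cnj (v $ j)) else 0)
        + 4 / s / s * v $ i * cnj (v $ j) * (v $ k * cnj (v $ k)))"
      unfolding index_mult_mat_sum[OF c c ij]
    proof (rule sum.cong[OF refl])
      fix k assume "k \<in> {..<n}"
      then have k: "k < n" by simp
      show "?R $$ (i, k) * ?R $$ (k, j) = (if k = i then if i = j then 1 else 0 else 0)
        - (if k = i then 2 / s * (v $ i * cnj (v $ j)) else 0)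
        - (if k = j then 2 / s * (v $ i * cnj (v $ j)) else 0)
        + 4 / s / s * v $ i * cnj (v $ j) * (v $ k * cnj (v $ k))"
        unfolding index_reflection_mat[OF ij(1) k] index_reflection_mat[OF k ij(2)] s_def[symmetric]
        using s by (cases "k = i"; cases "k = j") (simp_all add: field_simps)
    qed
    also have "\<dots> = (if i = j then 1 else 0) - 2 / s * (v $ i * cnj (v $ j))
        - 2 / s * (v $ i * cnj (v $ j)) + 4 / s / s * v $ i * cnj (v $ j) * s"
      unfolding sum.distrib sum_subtractf sum_distrib_left[symmetric]
      using ij by (simp add: s_def cscalar_prod_sum[OF v])
    finally show "(?R * ?R) $$ (i, j) = 1\<^sub>m n $$ (i, j)" using s ij by (simp add: field_simps)
  qed (use c in auto)
  then show ?thesis unfolding unitary_mat_def using c adj by simp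
qed

lemma unitary_phase_mat: "unitary_mat n (phase_mat n k \<theta>)"
proof -
  let ?d = "\<lambda>i. if i = k then cis \<theta> else 1"
  have c: "mat_diag n ?d \<in> carrier_mat n n" by simp
  have "mat_adjoint (mat_diag n ?d) = mat_diag n (\<lambda>i. cnj (?d i))"
  proof (rule eq_matI)
    show "dim_row (mat_adjoint (mat_diag n ?d)) = dim_row (mat_diag n (\<lambda>i. cnj (?d i)))"
      "dim_col (mat_adjoint (mat_diag n ?d)) = dim_col (mat_diag n (\<lambda>i. cnj (?d i)))"
      using mat_adjoint_carrier[OF c] by (auto simp: mat_diag_def)
    fix i j assume "i < dim_row (mat_diag n (\<lambda>i. cnj (?d i)))" "j < dim_col (mat_diag n (\<lambda>i. cnj (?d i)))"
    then have ij: "i < n" "j < n" by (auto simp: mat_diag_def)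
    show "mat_adjoint (mat_diag n ?d) $$ (i, j) = mat_diag n (\<lambda>i. cnj (?d i)) $$ (i, j)"
      unfolding index_mat_adjoint[OF c ij] using ij by (auto simp: mat_diag_def)
  qed
  moreover have "(\<lambda>i. ?d i * cnj (?d i)) = (\<lambda>i. 1)" "(\<lambda>i. cnj (?d i) * ?d i) = (\<lambda>i. 1)"
    by (auto simp: cis_cnj cis_mult)
  ultimately show ?thesis
    unfolding phase_mat_def unitary_mat_def by simp
qed

lemma index_phase_mat_mult_vec:
  "x \<in> carrier_vec n \<Longrightarrow> i < n \<Longrightarrow>
    (phase_mat n k \<theta> *\<^sub>v x) $ i = (if i = k then cis \<theta> else 1) * x $ i"
  by (subst index_mult_mat_vec_sum[of _ n n])
    (auto simp: phase_mat_def mat_diag_def if_distrib[of "\<lambda>z. z * _"] cong: if_cong)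

text \<open>The reflection in w - y swaps w and y when the norms agree and
  \<open>w \<bullet>c y\<close> is real. The choice y = |w| cis(Arg w_m) e_m meets both conditions,
  and a phase factor at coordinate \<open>m\<close> then makes the result positive. Since w - y
  vanishes in the coordinates below \<open>m\<close>, the last two conclusions follow.\<close>

lemma householder_exists:
  fixes w :: "complex Matrix.vec"
  assumes m: "m < n" and w: "w \<in> carrier_vec n" and nz: "w \<noteq> 0\<^sub>v n"
    and head: "\<And>i. i < m \<Longrightarrow> w $ i = 0"
  obtains R c where "householder n R" "c > 0" "R *\<^sub>v w = of_real c \<cdot>\<^sub>v unit_vec n m"
    "\<And>x i. x \<in> carrier_vec n \<Longrightarrow> i < m \<Longrightarrow> (R *\<^sub>v x) $ i = x $ i"
    "\<And>x. x \<in> carrier_vec n \<Longrightarrow> (\<And>i. m \<le> i \<Longrightarrow> i < n \<Longrightarrow> x $ i = 0) \<Longrightarrow> R *\<^sub>v x = x"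
proof -
  define c where "c = sqrt (\<Sum>i<n. (cmod (w $ i))\<^sup>2)"
  have c2: "c\<^sup>2 = (\<Sum>i<n. (cmod (w $ i))\<^sup>2)" unfolding c_def by (simp add: sum_nonneg)
  have ww: "w \<bullet>c w = of_real (c\<^sup>2)" unfolding c2 cscalar_prod_self[OF w] ..
  have "c \<noteq> 0" using ww w nz by (metis conjugate_square_eq_0_vec of_real_0 zero_power2)
  moreover have "c \<ge> 0" unfolding c_def by (simp add: sum_nonneg)
  ultimately have c: "c > 0" by simp
  define \<theta> where "\<theta> = Arg (w $ m)"
  have pol: "w $ m = of_real (cmod (w $ m)) * cis \<theta>"
    unfolding \<theta>_def by (metis rcis_cmod_Arg rcis_def)
  define y where "y = (of_real c * cis \<theta>) \<cdot>\<^sub>v unit_vec n m"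
  have y: "y \<in> carrier_vec n" unfolding y_def by simp
  have y_i: "y $ i = (if i = m then of_real c * cis \<theta> else 0)" if "i < n" for i
    using that m unfolding y_def by auto
  have yy: "y \<bullet>c y = of_real (c\<^sup>2)"
  proof -
    have "y \<bullet>c y = (\<Sum>i<n. if i = m then of_real c * cis \<theta> * cnj (of_real c * cis \<theta>) else 0)"
      unfolding cscalar_prod_sum[OF y] by (rule sum.cong) (auto simp: y_i)
    then show ?thesis using m by (simp add: power2_eq_square cis_cnj cis_mult)
  qed
  have wy: "w \<bullet>c y = of_real (c * cmod (w $ m))" 
  proof -
    have "w \<bullet>c y = (\<Sum>i<n. if i = m then w $ m * cnj (of_real c * cis \<theta>) else 0)"
      unfolding cscalar_prod_sum[OF y] by (rule sum.cong) (auto simp: y_i)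
    also have "\<dots> = of_real (cmod (w $ m)) * cis \<theta> * cnj (of_real c * cis \<theta>)"
      using m pol by simp
    finally show ?thesis by (simp add: cis_cnj cis_mult)
  qed
  have yw: "y \<bullet>c w = of_real (c * cmod (w $ m))"
  proof -
    have "y \<bullet>c w = cnj (w \<bullet>c y)"
      unfolding cscalar_prod_sum[OF y] cscalar_prod_sum[OF w] by (simp add: mult.commute)
    then show ?thesis unfolding wy by simp
  qed
  define v where "v = w - y"
  have v: "v \<in> carrier_vec n" unfolding v_def using w y by simp
  have v_i: "v $ i = w $ i - y $ i" if "i < n" for i
    unfolding v_def using that w y by simp
  have wv: "w \<bullet>c v = w \<bullet>c w - w \<bullet>c y"
    unfolding cscalar_prod_sum[OF v] cscalar_prod_sum[OF w] cscalar_prod_sum[OF y]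
    by (simp add: v_i sum_subtractf[symmetric] algebra_simps)
  have vv: "v \<bullet>c v = w \<bullet>c w - w \<bullet>c y - y \<bullet>c w + y \<bullet>c y"
    unfolding cscalar_prod_sum[OF v] cscalar_prod_sum[OF w] cscalar_prod_sum[OF y]
    by (simp add: v_i sum_subtractf[symmetric] sum.distrib[symmetric] algebra_simps)
  \<comment> \<open>Hence the coefficient of \<open>v\<close> in the reflection of \<open>w\<close>
    is 1, and the image is w - v = y.\<close>
  have vv2: "v \<bullet>c v = 2 * (w \<bullet>c v)" unfolding vv wv ww wy yw yy by simp
  \<comment> \<open>For \<open>v = 0\<close> the vector \<open>w\<close> already equals
    \<open>y\<close>; a reflection needs a nonzero vector, so the identity takes its place.\<close>
  define R0 where "R0 = (if v = 0\<^sub>v n then 1\<^sub>m n else reflection_mat n v)"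
  have R0_u: "unitary_mat n R0"
    unfolding R0_def using unitary_mat_one unitary_reflection_mat[OF v] by auto
  note R0 = unitary_matD(1)[OF R0_u]
  have R0_w: "R0 *\<^sub>v w = y"
  proof (rule eq_vecI)
    fix i assume "i < dim_vec y"
    then have i: "i < n" using y by simp
    show "(R0 *\<^sub>v w) $ i = y $ i"
    proof (cases "v = 0\<^sub>v n")
      case True
      then show ?thesis unfolding R0_def using v_i[OF i] i w by simp
    next
      case False
      then have "v \<bullet>c v \<noteq> 0" using v by simp
      then have "2 * (w \<bullet>c v) / (v \<bullet>c v) = 1" using vv2 by simp
      then show ?thesis
        using False index_reflection_mat_mult_vec[OF v w i] v_i[OF i] unfolding R0_def by simp
    qed
  qed (use R0 y in auto)
  have v_head: "v $ i = 0" if "i < m" for i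
    using that m v_i[of i] y_i[of i] head[of i] by simp
  have R0_head: "(R0 *\<^sub>v x) $ i = x $ i" if "x \<in> carrier_vec n" "i < m" for x i
    using that m v_head[of i] index_reflection_mat_mult_vec[OF v, of x i] unfolding R0_def by auto
  have R0_tail: "R0 *\<^sub>v x = x"
    if x: "x \<in> carrier_vec n" and z: "\<And>i. m \<le> i \<Longrightarrow> i < n \<Longrightarrow> x $ i = 0" for x
  proof (cases "v = 0\<^sub>v n")
    case False
    have "x \<bullet>c v = 0" unfolding cscalar_prod_sum[OF v]
      by (rule sum.neutral) (use z v_head in \<open>auto simp: not_less[symmetric]\<close>)
    then show ?thesis using False index_reflection_mat_mult_vec[OF v x] x R0
      unfolding R0_def by (intro eq_vecI) auto
  qed (use x in \<open>simp add: R0_def\<close>)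
  define R where "R = phase_mat n m (-\<theta>) * R0"
  note P = unitary_phase_mat[of n m "-\<theta>"]
  have hh: "householder n R"
    unfolding householder_def R_def
    using unitary_mat_mult[OF P R0_u] m v unfolding R0_def by (auto intro!: exI[of _ m])
  have R_i: "(R *\<^sub>v x) $ i = (if i = m then cis (-\<theta>) else 1) * (R0 *\<^sub>v x) $ i"
    if "x \<in> carrier_vec n" "i < n" for x i
    unfolding R_def assoc_mult_mat_vec[OF unitary_matD(1)[OF P] R0 that(1)]
    by (rule index_phase_mat_mult_vec) (use that R0 in auto)
  have Rc: "R \<in> carrier_mat n n" using hh unfolding householder_def unitary_mat_def by auto
  show thesis
  proof (rule that[OF hh c])
    show "R *\<^sub>v w = of_real c \<cdot>\<^sub>v unit_vec n m"
    proof (rule eq_vecI)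
      fix i assume "i < dim_vec (of_real c \<cdot>\<^sub>v unit_vec n m :: complex Matrix.vec)"
      then have i: "i < n" by simp
      then show "(R *\<^sub>v w) $ i = (of_real c \<cdot>\<^sub>v unit_vec n m) $ i"
        unfolding R_i[OF w i] R0_w y_i[OF i] using m by (simp add: cis_mult)
    qed (use Rc in auto)
    fix x :: "complex Matrix.vec" assume x: "x \<in> carrier_vec n"
    show "(R *\<^sub>v x) $ i = x $ i" if "i < m" for i
      unfolding R_i[OF x less_trans[OF that m]] R0_head[OF x that] using that by simp
    show "R *\<^sub>v x = x" if z: "\<And>i. m \<le> i \<Longrightarrow> i < n \<Longrightarrow> x $ i = 0"
    proof (rule eq_vecI)
      fix i assume "i < dim_vec x"
      then have i: "i < n" using x by simp
      show "(R *\<^sub>v x) $ i = x $ i"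
        unfolding R_i[OF x i] using R0_tail[OF x z] z[of m] m by simp
    qed (use Rc x in auto)
  qed
qed

section \<open>Conjugation fixing the leading coordinates\<close>

text \<open>For \<open>m \<le> n\<close> this is the block form 1 + R' (direct sum) with an identity
  block of size \<open>m\<close>. It is phrased through the action on vectors because the matrices
  are tracked column by column.\<close>

definition fixes_head :: "nat \<Rightarrow> nat \<Rightarrow> complex mat \<Rightarrow> bool" where
  "fixes_head n m R \<longleftrightarrow> unitary_mat n R \<and>
     (\<forall>x \<in> carrier_vec n. (\<forall>i<m. (R *\<^sub>v x) $ i = x $ i) \<and>
        ((\<forall>i. m \<le> i \<longrightarrow> i < n \<longrightarrow> x $ i = 0) \<longrightarrow> R *\<^sub>v x = x))"

lemma fixes_headD:
  assumes "fixes_head n m R"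
  shows "unitary_mat n R"
    "x \<in> carrier_vec n \<Longrightarrow> i < m \<Longrightarrow> (R *\<^sub>v x) $ i = x $ i"
    "x \<in> carrier_vec n \<Longrightarrow> (\<And>i. m \<le> i \<Longrightarrow> i < n \<Longrightarrow> x $ i = 0) \<Longrightarrow> R *\<^sub>v x = x"
  using assms unfolding fixes_head_def by blast+

lemma mult_mat_unit_vec:
  fixes A :: "complex mat"
  shows "A \<in> carrier_mat n n \<Longrightarrow> i < n \<Longrightarrow> A *\<^sub>v unit_vec n i = col A i"
  by (rule eq_vecI) auto

lemma fixes_head_unit_vec:
  assumes R: "fixes_head n m R" and c: "c < m" "c < n"
  shows "R *\<^sub>v unit_vec n c = unit_vec n c"
  using c by (intro fixes_headD(3)[OF R]) auto

lemma fixes_head_adjoint_unit_vec: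
  assumes R: "fixes_head n m R" and c: "c < m" "c < n"
  shows "mat_adjoint R *\<^sub>v unit_vec n c = unit_vec n c"
proof -
  note U = unitary_matD[OF fixes_headD(1)[OF R]]
  have "mat_adjoint R *\<^sub>v (R *\<^sub>v unit_vec n c) = unit_vec n c"
    unfolding assoc_mult_mat_vec[OF U(2,1) unit_vec_carrier, symmetric] U(4) by simp
  then show ?thesis unfolding fixes_head_unit_vec[OF R c] .
qed

text \<open>The right factor has no effect on column \<open>c\<close>: the adjoint of
  \<open>R\<close> fixes e_c because \<open>c < m\<close>. On such columns conjugation is plain left
  multiplication.\<close>

lemma col_conj_fixes_head:
  assumes R: "fixes_head n m R" and A: "A \<in> carrier_mat n n" and c: "c < m" "c < n"
  shows "col (R * A * mat_adjoint R) c = R *\<^sub>v col A c"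
proof -
  note U = unitary_matD[OF fixes_headD(1)[OF R]]
  have RA: "R * A \<in> carrier_mat n n" using U A by simp
  have "col (R * A * mat_adjoint R) c = (R * A * mat_adjoint R) *\<^sub>v unit_vec n c"
    using mult_mat_unit_vec[of "R * A * mat_adjoint R" n c] RA U(2) c by simp
  also have "\<dots> = R * A *\<^sub>v (mat_adjoint R *\<^sub>v unit_vec n c)"
    by (rule assoc_mult_mat_vec[OF RA U(2) unit_vec_carrier])
  also have "\<dots> = R *\<^sub>v (A *\<^sub>v unit_vec n c)"
    unfolding fixes_head_adjoint_unit_vec[OF R c]
    by (rule assoc_mult_mat_vec[OF U(1) A unit_vec_carrier])
  finally show ?thesis unfolding mult_mat_unit_vec[OF A c(2)] .
qed

lemma mat_adjoint_conj:
  fixes R A :: "complex mat"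
  assumes R: "R \<in> carrier_mat n n" and A: "A \<in> carrier_mat n n"
  shows "mat_adjoint (R * A * mat_adjoint R) = R * mat_adjoint A * mat_adjoint R"
proof -
  note R' = mat_adjoint_carrier[OF R] and A' = mat_adjoint_carrier[OF A]
  have "mat_adjoint (R * A * mat_adjoint R) = R * (mat_adjoint A * mat_adjoint R)"
    unfolding mat_adjoint_mult[OF mult_carrier_mat[OF R A] R'] mat_adjoint_mult[OF R A]
      mat_adjoint_mat_adjoint[OF R] ..
  then show ?thesis unfolding assoc_mult_mat[OF R A' R'] .
qed

lemma conj_conj:
  fixes Q R A :: "complex mat"
  assumes R: "R \<in> carrier_mat n n" and Q: "Q \<in> carrier_mat n n" and A: "A \<in> carrier_mat n n"
  shows "R * (Q * A * mat_adjoint Q) * mat_adjoint R = (R * Q) * A * mat_adjoint (R * Q)"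
proof -
  note R' = mat_adjoint_carrier[OF R] and Q' = mat_adjoint_carrier[OF Q]
  note mc = mult_carrier_mat[of _ n n _ n]
  have "R * (Q * A * mat_adjoint Q) * mat_adjoint R = (R * (Q * A)) * mat_adjoint Q * mat_adjoint R"
    unfolding assoc_mult_mat[OF R mc[OF Q A] Q'] ..
  also have "\<dots> = (R * Q) * A * (mat_adjoint Q * mat_adjoint R)"
    unfolding assoc_mult_mat[OF mc[OF R mc[OF Q A]] Q' R'] assoc_mult_mat[OF R Q A] ..
  finally show ?thesis unfolding mat_adjoint_mult[OF R Q] .
qed

lemma unitary_mat_conj:
  "unitary_mat n R \<Longrightarrow> unitary_mat n A \<Longrightarrow> unitary_mat n (R * A * mat_adjoint R)"
  by (intro unitary_mat_mult unitary_mat_adjoint)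

section \<open>Pivots and their behaviour under conjugation\<close>

definition pivot_at :: "nat \<Rightarrow> complex mat \<Rightarrow> nat \<Rightarrow> nat \<Rightarrow> bool" where
  "pivot_at n A m c \<longleftrightarrow> pos_real (A $$ (m, c)) \<and> (\<forall>k. m < k \<longrightarrow> k < n \<longrightarrow> A $$ (k, c) = 0)"

lemma pos_real_cnj: "pos_real (cnj z) \<longleftrightarrow> pos_real z"
  unfolding pos_real_def by (metis Reals_cnj_iff complex_cnj_cnj cnj.sel(1))

lemma pos_real_nonzero: "pos_real z \<Longrightarrow> z \<noteq> 0"
  unfolding pos_real_def by auto

lemma index_conj_fixes_head:
  assumes R: "fixes_head n m R" and A: "A \<in> carrier_mat n n" and c: "c < m" "c < n" and k: "k < n"
  shows "(R * A * mat_adjoint R) $$ (k, c) = (R *\<^sub>v col A c) $ k"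
proof -
  note U = unitary_matD[OF fixes_headD(1)[OF R]]
  have "R * A * mat_adjoint R \<in> carrier_mat n n" using U A by simp
  then have "(R * A * mat_adjoint R) $$ (k, c) = col (R * A * mat_adjoint R) c $ k"
    by (intro index_col[symmetric]) (use c k in auto)
  then show ?thesis unfolding col_conj_fixes_head[OF R A c] .
qed

text \<open>Column \<open>c\<close> is supported in rows up to \<open>k < m\<close>, where
  \<open>R\<close> acts as the identity, so the whole column is unchanged. This is why later
  reflections do not undo earlier ones.\<close>

lemma pivot_at_conj:
  assumes R: "fixes_head n m R" and A: "A \<in> carrier_mat n n"
    and c: "c < k" "k < m" "m \<le> n" and p: "pivot_at n A k c"
  shows "pivot_at n (R * A * mat_adjoint R) k c"
proof -
  have cm: "c < m" "c < n" and cA: "col A c \<in> carrier_vec n" using c A by auto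
  have "R *\<^sub>v col A c = col A c"
    by (rule fixes_headD(3)[OF R cA]) (use p c A in \<open>auto simp: pivot_at_def\<close>)
  then have "(R * A * mat_adjoint R) $$ (i, c) = A $$ (i, c)" if "i < n" for i
    unfolding index_conj_fixes_head[OF R A cm that] using that A cm by simp
  then show ?thesis using p c unfolding pivot_at_def by simp
qed

lemma householder_fixes_head:
  assumes m: "m < n" and w: "w \<in> carrier_vec n" and nz: "w \<noteq> 0\<^sub>v n"
    and head: "\<And>i. i < m \<Longrightarrow> w $ i = 0"
  obtains R c where "householder n R" "fixes_head n m R" "c > 0"
    "R *\<^sub>v w = of_real c \<cdot>\<^sub>v unit_vec n m"
proof -
  obtain R c where R: "householder n R" "c > 0" "R *\<^sub>v w = of_real c \<cdot>\<^sub>v unit_vec n m"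
    "\<And>x i. x \<in> carrier_vec n \<Longrightarrow> i < m \<Longrightarrow> (R *\<^sub>v x) $ i = x $ i"
    "\<And>x. x \<in> carrier_vec n \<Longrightarrow> (\<And>i. m \<le> i \<Longrightarrow> i < n \<Longrightarrow> x $ i = 0) \<Longrightarrow> R *\<^sub>v x = x"
    using householder_exists[OF m w nz head] by blast
  have "unitary_mat n R" using R(1) unfolding householder_def by blast
  then have "fixes_head n m R" unfolding fixes_head_def using R(4,5) by blast
  then show thesis using that R(1-3) by blast
qed

lemma pivot_at_create:
  assumes A: "A \<in> carrier_mat n n" and c: "c < m" and k: "m \<le> k" "k < n"
    and nz: "A $$ (k, c) \<noteq> 0"
  obtains R where "householder n R" "fixes_head n m R" "pivot_at n (R * A * mat_adjoint R) m c"
proof -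
  have m: "m < n" "c < n" using c k by auto
  \<comment> \<open>The column is split at row \<open>m\<close>: \<open>R\<close> fixes the upper
    part \<open>h\<close>, and the reflection is chosen for the lower part \<open>w\<close>.\<close>
  define h where "h = Matrix.vec n (\<lambda>i. if i < m then A $$ (i, c) else 0)"
  define w where "w = Matrix.vec n (\<lambda>i. if i < m then 0 else A $$ (i, c))"
  have hc: "h \<in> carrier_vec n" and wc: "w \<in> carrier_vec n" unfolding h_def w_def by auto
  have "w $ k \<noteq> 0" using k nz unfolding w_def by simp
  then have "w \<noteq> 0\<^sub>v n" using k by auto
  moreover have "w $ i = 0" if "i < m" for i using that m unfolding w_def by simp
  ultimately obtain R r where R: "householder n R" "fixes_head n m R" and r: "r > 0"
    and Rw: "R *\<^sub>v w = of_real r \<cdot>\<^sub>v unit_vec n m"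
    using householder_fixes_head[OF m(1) wc] by metis
  note U = unitary_matD[OF fixes_headD(1)[OF R(2)]]
  have "col A c = h + w" unfolding h_def w_def by (rule eq_vecI) (use A m in auto)
  moreover have "R *\<^sub>v h = h"
    by (rule fixes_headD(3)[OF R(2) hc]) (auto simp: h_def)
  ultimately have Rc: "R *\<^sub>v col A c = h + of_real r \<cdot>\<^sub>v unit_vec n m"
    using mult_add_distrib_mat_vec[OF U(1) hc wc] Rw by simp
  have "(R * A * mat_adjoint R) $$ (i, c) = (if i = m then of_real r else 0)" if "m \<le> i" "i < n" for i
    unfolding index_conj_fixes_head[OF R(2) A c m(2) that(2)] Rc
    using that m hc by (simp add: h_def)
  then have "pivot_at n (R * A * mat_adjoint R) m c"
    unfolding pivot_at_def pos_real_def using m r by simp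
  then show thesis using that R by blast
qed

section \<open>Diagonalisation and spectral measures of unitary matrices\<close>

text \<open>The vanishing upper right block makes the span of e_m, ..., e_(n-1) invariant. The lower
  right block has an eigenvector over the complex numbers, and padding it with zeros gives
  \<open>w\<close>.\<close>

lemma eigenvector_lower_block:
  fixes B :: "complex mat"
  assumes B: "B \<in> carrier_mat n n" and m: "m < n"
    and z: "\<And>i j. i < m \<Longrightarrow> m \<le> j \<Longrightarrow> j < n \<Longrightarrow> B $$ (i, j) = 0"
  obtains w l where "w \<in> carrier_vec n" "w \<noteq> 0\<^sub>v n" "\<And>i. i < m \<Longrightarrow> w $ i = 0"
    "B *\<^sub>v w = l \<cdot>\<^sub>v w"
proof -
  define M where "M = Matrix.mat (n - m) (n - m) (\<lambda>(i, j). B $$ (i + m, j + m))"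
  have M: "M \<in> carrier_mat (n - m) (n - m)" unfolding M_def by simp
  from spectrum_non_empty[OF M] m obtain l v where "eigenvector M v l"
    unfolding spectrum_def eigenvalue_def by auto
  then have v: "v \<in> carrier_vec (n - m)" and v0: "v \<noteq> 0\<^sub>v (n - m)" and ev: "M *\<^sub>v v = l \<cdot>\<^sub>v v"
    unfolding eigenvector_def using M by auto
  define w where "w = Matrix.vec n (\<lambda>i. if i < m then 0 else v $ (i - m))"
  have w: "w \<in> carrier_vec n" unfolding w_def by simp
  have w_i: "w $ i = (if i < m then 0 else v $ (i - m))" if "i < n" for i
    unfolding w_def using that by simp
  show thesis
  proof (rule that[OF w])
    show "w \<noteq> 0\<^sub>v n"
    proof
      assume w0: "w = 0\<^sub>v n"
      have "v = 0\<^sub>v (n - m)"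
      proof (rule eq_vecI)
        fix i assume "i < dim_vec (0\<^sub>v (n - m) :: complex Matrix.vec)"
        then show "v $ i = 0\<^sub>v (n - m) $ i" using w_i[of "i + m"] w0 by simp
      qed (use v in simp)
      then show False using v0 by simp
    qed
    show "w $ i = 0" if "i < m" for i using that m w_i by simp
    show "B *\<^sub>v w = l \<cdot>\<^sub>v w"
    proof (rule eq_vecI)
      fix i assume "i < dim_vec (l \<cdot>\<^sub>v w)"
      then have i: "i < n" using w by simp
      have "(B *\<^sub>v w) $ i = (\<Sum>j<n. B $$ (i, j) * w $ j)"
        by (rule index_mult_mat_vec_sum[OF B w i])
      also have "\<dots> = l * w $ i"
      proof (cases "i < m")
        case True
        have "(\<Sum>j<n. B $$ (i, j) * w $ j) = 0"
          by (rule sum.neutral) (use True z in \<open>auto simp: w_i\<close>)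
        then show ?thesis using w_i[OF i] True by simp
      next
        case False
        have "(\<Sum>j<n. B $$ (i, j) * w $ j) = (\<Sum>j\<in>{m..<n}. B $$ (i, j) * w $ j)"
          by (rule sum.mono_neutral_right) (auto simp: w_i)
        also have "\<dots> = (\<Sum>j<n - m. M $$ (i - m, j) * v $ j)"
          by (rule sum.reindex_bij_witness[of _ "\<lambda>j. j + m" "\<lambda>j. j - m"])
            (use False i in \<open>auto simp: w_i M_def\<close>)
        also have "\<dots> = (M *\<^sub>v v) $ (i - m)"
          using index_mult_mat_vec_sum[OF M v, of "i - m"] i False by simp
        also have "\<dots> = l * w $ i" unfolding ev using i False v w_i[OF i] by simp
        finally show ?thesis .
      qed
      finally show "(B *\<^sub>v w) $ i = (l \<cdot>\<^sub>v w) $ i" using w i by simp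
    qed (use B w in auto)
  qed
qed

text \<open>Column \<open>c\<close> is a multiple of e_c, nonzero because it has norm 1;
  orthogonality to column \<open>j\<close> does the rest.\<close>

lemma unitary_mat_diagonal_row:
  assumes B: "unitary_mat n B" and c: "c < n"
    and z: "\<And>k. k < n \<Longrightarrow> k \<noteq> c \<Longrightarrow> B $$ (k, c) = 0" and j: "j < n" "j \<noteq> c"
  shows "B $$ (c, j) = 0"
proof (rule unitary_mat_pivot[OF B c c j(1)])
  show "B $$ (c, c) \<noteq> 0"
  proof
    assume "B $$ (c, c) = 0"
    then have "(\<Sum>k<n. cnj (B $$ (k, c)) * B $$ (k, c)) = 0"
      using z by (intro sum.neutral) (metis lessThan_iff mult_zero_right)
    then show False using unitary_mat_col_inner[OF B c c] by simp
  qed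
qed (use j z in auto)

text \<open>Deflation: an eigenvector supported in rows \<open>m\<close> and beyond is reflected
  onto a multiple of e_m. The first \<open>m\<close> columns, already multiples of coordinate
  vectors, are left alone.\<close>

lemma unitary_mat_partial_diag:
  assumes A: "unitary_mat n A"
  shows "m \<le> n \<Longrightarrow> \<exists>Q. unitary_mat n Q \<and>
    (\<forall>c<m. \<forall>k<n. k \<noteq> c \<longrightarrow> (Q * A * mat_adjoint Q) $$ (k, c) = 0)"
proof (induction m)
  case 0
  then show ?case using unitary_mat_one by auto
next
  case (Suc m)
  then obtain Q where Q: "unitary_mat n Q"
    and z: "\<And>c k. c < m \<Longrightarrow> k < n \<Longrightarrow> k \<noteq> c \<Longrightarrow> (Q * A * mat_adjoint Q) $$ (k, c) = 0"
    by auto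
  have m: "m < n" using Suc by simp
  define B where "B = Q * A * mat_adjoint Q"
  have Bu: "unitary_mat n B" unfolding B_def by (rule unitary_mat_conj[OF Q A])
  note Bc = unitary_matD(1)[OF Bu]
  note zB = z[folded B_def]
  \<comment> \<open>Unitarity turns diagonal columns into diagonal rows; this supplies the vanishing
    upper right block.\<close>
  have row: "B $$ (i, j) = 0" if "i < m" "m \<le> j" "j < n" for i j
    by (rule unitary_mat_diagonal_row[OF Bu]) (use that m zB in auto)
  obtain w l where w: "w \<in> carrier_vec n" "w \<noteq> 0\<^sub>v n" "\<And>i. i < m \<Longrightarrow> w $ i = 0"
    and ev: "B *\<^sub>v w = l \<cdot>\<^sub>v w"
    by (rule eigenvector_lower_block[OF Bc m]) (use row in blast)+
  obtain R r where R: "fixes_head n m R" and r: "r > 0" "R *\<^sub>v w = of_real r \<cdot>\<^sub>v unit_vec n m"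
    using householder_fixes_head[OF m w] by metis
  note Ru = fixes_headD(1)[OF R]
  note U = unitary_matD[OF Ru]
  define e where "e = (unit_vec n m :: complex Matrix.vec)"
  have e: "e \<in> carrier_vec n" unfolding e_def by simp
  \<comment> \<open>Inverting \<open>R\<close> shows that the preimage of e_m is a multiple of
    \<open>w\<close>, hence an eigenvector of \<open>B\<close>; so e_m is one of the conjugated
    matrix.\<close>
  have "w = mat_adjoint R *\<^sub>v (R *\<^sub>v w)"
    unfolding assoc_mult_mat_vec[OF U(2,1) w(1), symmetric] U(4) using w(1) by simp
  also have "\<dots> = of_real r \<cdot>\<^sub>v (mat_adjoint R *\<^sub>v e)"
    unfolding r e_def by (rule mult_mat_vec[OF U(2)]) simp
  finally have w_eq: "w = of_real r \<cdot>\<^sub>v (mat_adjoint R *\<^sub>v e)" .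
  have Re: "mat_adjoint R *\<^sub>v e = (1 / of_real r) \<cdot>\<^sub>v w"
    unfolding w_eq using r(1) U(2) by (intro eq_vecI) auto
  let ?B' = "R * B * mat_adjoint R"
  have B'c: "?B' \<in> carrier_mat n n" using U Bc by simp
  have "?B' *\<^sub>v e = R * B *\<^sub>v (mat_adjoint R *\<^sub>v e)"
    using assoc_mult_mat_vec[OF mult_carrier_mat[OF U(1) Bc] U(2) e] .
  also have "\<dots> = R *\<^sub>v (B *\<^sub>v (mat_adjoint R *\<^sub>v e))"
    by (rule assoc_mult_mat_vec[OF U(1) Bc mult_mat_vec_carrier[OF U(2) e]])
  also have "B *\<^sub>v (mat_adjoint R *\<^sub>v e) = (1 / of_real r) \<cdot>\<^sub>v (l \<cdot>\<^sub>v w)"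
    unfolding Re mult_mat_vec[OF Bc w(1)] ev ..
  also have "R *\<^sub>v \<dots> = (1 / of_real r) \<cdot>\<^sub>v (R *\<^sub>v (l \<cdot>\<^sub>v w))"
    by (rule mult_mat_vec[OF U(1)]) (use w(1) in simp)
  also have "R *\<^sub>v (l \<cdot>\<^sub>v w) = l \<cdot>\<^sub>v (of_real r \<cdot>\<^sub>v e)"
    unfolding mult_mat_vec[OF U(1) w(1)] r(2) e_def ..
  finally have "col ?B' m = (1 / of_real r) \<cdot>\<^sub>v (l \<cdot>\<^sub>v (of_real r \<cdot>\<^sub>v e))"
    unfolding e_def mult_mat_unit_vec[OF B'c m] .
  note col_m = this
  have new: "?B' $$ (k, m) = 0" if "k < n" "k \<noteq> m" for k
  proof -
    have "?B' $$ (k, m) = col ?B' m $ k"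
      by (rule index_col[symmetric]) (use B'c that m in auto)
    then show ?thesis unfolding col_m e_def using that m by simp
  qed
  have old: "?B' $$ (k, c) = 0" if "c < m" "k < n" "k \<noteq> c" for c k
  proof -
    have cn: "c < n" using that m by simp
    have "R *\<^sub>v col B c = col B c"
      by (rule fixes_headD(3)[OF R]) (use zB[OF that(1)] that Bc cn in auto)
    then show ?thesis
      unfolding index_conj_fixes_head[OF R Bc that(1) cn that(2)] using zB[OF that] that cn Bc by simp
  qed
  have "?B' = (R * Q) * A * mat_adjoint (R * Q)"
    unfolding B_def by (rule conj_conj[OF U(1) unitary_matD(1)[OF Q] unitary_matD(1)[OF A]])
  then show ?case
    using unitary_mat_mult[OF Ru Q] new old by (metis less_antisym)
qed

lemma unitary_mat_diagonalizable:
  assumes A: "unitary_mat n A"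
  obtains W d where "unitary_mat n W" "A = W * mat_diag n d * mat_adjoint W"
    "\<And>i. i < n \<Longrightarrow> cmod (d i) = 1"
proof -
  obtain Q where Q: "unitary_mat n Q"
    and z: "\<And>c k. c < n \<Longrightarrow> k < n \<Longrightarrow> k \<noteq> c \<Longrightarrow> (Q * A * mat_adjoint Q) $$ (k, c) = 0"
    using unitary_mat_partial_diag[OF A order_refl] by auto
  note Ac = unitary_matD(1)[OF A] and U = unitary_matD[OF Q]
  define D where "D = Q * A * mat_adjoint Q"
  define d where "d = (\<lambda>i. D $$ (i, i))"
  have Du: "unitary_mat n D" unfolding D_def by (rule unitary_mat_conj[OF Q A])
  note Dc = unitary_matD(1)[OF Du]
  have D: "D = mat_diag n d"
    by (rule eq_matI) (use Dc z in \<open>auto simp: mat_diag_def d_def D_def[symmetric]\<close>)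
  have "mat_adjoint Q * D * mat_adjoint (mat_adjoint Q) =
      (mat_adjoint Q * Q) * A * mat_adjoint (mat_adjoint Q * Q)"
    unfolding D_def by (rule conj_conj[OF U(2) U(1) Ac])
  also have "\<dots> = 1\<^sub>m n * A * mat_adjoint (1\<^sub>m n)" unfolding U(4) ..
  also have "\<dots> = A" using unitary_matD[OF unitary_mat_one, of n] Ac
    by (metis left_mult_one_mat right_mult_one_mat)
  finally have "A = mat_adjoint Q * mat_diag n d * mat_adjoint (mat_adjoint Q)" unfolding D by simp
  moreover have "cmod (d i) = 1" if i: "i < n" for i
  proof -
    have "(\<Sum>k<n. D $$ (i, k) * cnj (D $$ (i, k))) = (\<Sum>k<n. if k = i then d i * cnj (d i) else 0)"
      by (rule sum.cong) (use i in \<open>auto simp: D mat_diag_def\<close>)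
    then have "d i * cnj (d i) = 1" using unitary_mat_row_inner[OF Du i i] i by simp
    then have "(cmod (d i))\<^sup>2 = 1" by (metis complex_norm_square of_real_eq_1_iff)
    then show ?thesis by (simp add: power2_eq_1_iff) (metis norm_ge_zero neg_0_le_iff_le not_one_le_zero)
  qed
  ultimately show thesis using that unitary_mat_adjoint[OF Q] by blast
qed

section \<open>Spectral measures through a diagonalisation\<close>

lemma cscalar_prod_adjoint:
  fixes A :: "complex mat"
  assumes A: "A \<in> carrier_mat n n" and x: "x \<in> carrier_vec n" and y: "y \<in> carrier_vec n"
  shows "(A *\<^sub>v x) \<bullet>c y = x \<bullet>c (mat_adjoint A *\<^sub>v y)"
proof -
  note A' = mat_adjoint_carrier[OF A]
  have "(A *\<^sub>v x) \<bullet>c y = (\<Sum>i<n. \<Sum>j<n. A $$ (i, j) * x $ j * cnj (y $ i))"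
    unfolding cscalar_prod_sum[OF y]
    by (rule sum.cong) (simp_all add: index_mult_mat_vec_sum[OF A x] sum_distrib_right
        del: index_mult_mat_vec)
  also have "\<dots> = (\<Sum>j<n. \<Sum>i<n. A $$ (i, j) * x $ j * cnj (y $ i))"
    by (rule sum.swap)
  also have "\<dots> = (\<Sum>j<n. x $ j * cnj ((mat_adjoint A *\<^sub>v y) $ j))"
  proof (rule sum.cong[OF refl])
    fix j assume "j \<in> {..<n}"
    then have j: "j < n" by simp
    have "(mat_adjoint A *\<^sub>v y) $ j = (\<Sum>i<n. cnj (A $$ (i, j)) * y $ i)"
      unfolding index_mult_mat_vec_sum[OF A' y j]
      by (rule sum.cong) (use j in \<open>simp_all add: index_mat_adjoint[OF A]\<close>)
    then show "(\<Sum>i<n. A $$ (i, j) * x $ j * cnj (y $ i)) = x $ j * cnj ((mat_adjoint A *\<^sub>v y) $ j)"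
      by (simp add: sum_distrib_left ac_simps del: index_mult_mat_vec)
  qed
  also have "\<dots> = x \<bullet>c (mat_adjoint A *\<^sub>v y)"
    by (rule cscalar_prod_sum[symmetric]) (use A' y in simp)
  finally show ?thesis .
qed

text \<open>Moving \<open>W\<close> across the inner product leaves a diagonal form in the vector
  \<open>mat_adjoint W\<close> applied to \<open>e\<close>, that is, in the coordinates of
  \<open>e\<close> with respect to the columns of \<open>W\<close>.\<close>

lemma diag_conj_inner:
  assumes W: "W \<in> carrier_mat n n" and e: "e \<in> carrier_vec n"
  shows "(W * mat_diag n g * mat_adjoint W *\<^sub>v e) \<bullet>c e =
    (\<Sum>i<n. (cmod ((mat_adjoint W *\<^sub>v e) $ i))\<^sup>2 *\<^sub>R g i)"
proof -
  note W' = mat_adjoint_carrier[OF W]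
  define p where "p = mat_adjoint W *\<^sub>v e"
  have p: "p \<in> carrier_vec n" unfolding p_def using W' e by simp
  have dc: "mat_diag n g \<in> carrier_mat n n" by simp
  have gp: "mat_diag n g *\<^sub>v p \<in> carrier_vec n" by (rule mult_mat_vec_carrier[OF dc p])
  have "W * mat_diag n g * mat_adjoint W *\<^sub>v e = W *\<^sub>v (mat_diag n g *\<^sub>v p)"
    unfolding p_def assoc_mult_mat_vec[OF mult_carrier_mat[OF W dc] W' e]
    by (rule assoc_mult_mat_vec[OF W dc]) (use W' e in simp)
  then have "(W * mat_diag n g * mat_adjoint W *\<^sub>v e) \<bullet>c e = (mat_diag n g *\<^sub>v p) \<bullet>c p"
    unfolding p_def by (metis cscalar_prod_adjoint[OF W gp e] p_def)
  also have "\<dots> = (\<Sum>i<n. (cmod (p $ i))\<^sup>2 *\<^sub>R g i)"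
    unfolding cscalar_prod_sum[OF p]
  proof (rule sum.cong[OF refl])
    fix i assume "i \<in> {..<n}"
    then have i: "i < n" by simp
    have "(mat_diag n g *\<^sub>v p) $ i = (\<Sum>j<n. if j = i then g i * p $ i else 0)"
      unfolding index_mult_mat_vec_sum[OF dc p i]
      by (rule sum.cong) (use i in \<open>auto simp: mat_diag_def\<close>)
    then have "(mat_diag n g *\<^sub>v p) $ i = g i * p $ i" using i by simp
    then show "(mat_diag n g *\<^sub>v p) $ i * cnj (p $ i) = (cmod (p $ i))\<^sup>2 *\<^sub>R g i"
      unfolding scaleR_conv_of_real complex_norm_square by simp
  qed
  finally show ?thesis unfolding p_def .
qed

text \<open>The atomic measure with mass |p_i|^2 at \<open>d i\<close>. As a push-forward along
  \<open>d\<close> it adds up the masses of coinciding eigenvalues.\<close>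

definition diag_spectral_measure ::
    "nat \<Rightarrow> (nat \<Rightarrow> complex) \<Rightarrow> complex Matrix.vec \<Rightarrow> complex measure" where
  "diag_spectral_measure n d p =
     distr (point_measure {..<n} (\<lambda>i. (cmod (p $ i))\<^sup>2)) (restrict_space borel (sphere 0 1)) d"

lemma spectral_measure_diag:
  assumes W: "unitary_mat n W" and d: "\<And>i. i < n \<Longrightarrow> cmod (d i) = 1"
    and e: "e \<in> carrier_vec n" "e \<bullet>c e = 1"
  shows "spectral_measure n (W * mat_diag n d * mat_adjoint W) e
    (diag_spectral_measure n d (mat_adjoint W *\<^sub>v e))"
proof -
  note U = unitary_matD[OF W]
  define p where "p = mat_adjoint W *\<^sub>v e"
  define P where "P = point_measure {..<n} (\<lambda>i. ennreal ((cmod (p $ i))\<^sup>2))"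
  define N where "N = restrict_space borel (sphere (0::complex) 1)"
  define \<mu> where "\<mu> = distr P N d"
  have d_meas: "d \<in> measurable P N"
    unfolding P_def N_def using d by (auto simp: space_restrict_space)
  have inner: "(W * mat_diag n g * mat_adjoint W *\<^sub>v e) \<bullet>c e = (\<Sum>i<n. (cmod (p $ i))\<^sup>2 *\<^sub>R g i)" for g
    unfolding p_def by (rule diag_conj_inner[OF U(1) e(1)])
  \<comment> \<open>The constant function 1 computes the total mass as
    \<open>e \<bullet>c e\<close>.\<close>
  have "complex_of_real (\<Sum>i<n. (cmod (p $ i))\<^sup>2) = (\<Sum>i<n. (cmod (p $ i))\<^sup>2 *\<^sub>R 1)"
    by (simp add: scaleR_conv_of_real)
  also have "\<dots> = (W * mat_diag n (\<lambda>i. 1) * mat_adjoint W *\<^sub>v e) \<bullet>c e" by (rule inner[symmetric])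
  also have "\<dots> = 1"
    unfolding mat_diag_one right_mult_one_mat[OF U(1)] U(3) one_mult_mat_vec[OF e(1)] by (rule e(2))
  finally have p1: "(\<Sum>i<n. (cmod (p $ i))\<^sup>2) = 1" using of_real_eq_1_iff by blast
  have "prob_space P"
  proof
    have "emeasure P (space P) = (\<Sum>i<n. ennreal ((cmod (p $ i))\<^sup>2))"
      unfolding P_def by (subst emeasure_point_measure_finite) (auto simp: space_point_measure)
    also have "\<dots> = 1" using p1 by (simp add: sum_ennreal)
    finally show "emeasure P (space P) = 1" .
  qed
  then have prob: "prob_space \<mu>" unfolding \<mu>_def by (rule prob_space.prob_space_distr[OF _ d_meas])
  have "spectral_measure n (W * mat_diag n d * mat_adjoint W) e \<mu>"
    unfolding spectral_measure_def
  proof (intro conjI ballI)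
    show "space \<mu> = sphere 0 1" unfolding \<mu>_def N_def by (simp add: space_restrict_space)
    show "sets \<mu> = sets (restrict_space borel (sphere 0 1))" unfolding \<mu>_def N_def by simp
    fix f :: "complex \<Rightarrow> complex" assume "f \<in> borel_measurable \<mu>"
    then have f: "f \<in> borel_measurable N" unfolding \<mu>_def by simp
    have "integrable P (\<lambda>i. f (d i))" unfolding P_def by (rule integrable_point_measure_finite) simp
    then have "integrable \<mu> f" unfolding \<mu>_def by (simp add: integrable_distr_eq[OF d_meas f])
    moreover have "(LINT z|\<mu>. f z) = (LINT i|P. f (d i))"
      unfolding \<mu>_def by (rule integral_distr[OF d_meas f])
    then have "(LINT z|\<mu>. f z) = (\<Sum>i<n. (cmod (p $ i))\<^sup>2 *\<^sub>R f (d i))"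
      unfolding P_def by (simp add: lebesgue_integral_point_measure_finite)
    moreover have "fun_calc n f (W * mat_diag n d * mat_adjoint W)
        (W * mat_diag n (\<lambda>i. f (d i)) * mat_adjoint W)"
      unfolding fun_calc_def using W by blast
    ultimately show "\<exists>F. fun_calc n f (W * mat_diag n d * mat_adjoint W) F \<and> integrable \<mu> f \<and>
        (F *\<^sub>v e) \<bullet>c e = (LINT z|\<mu>. f z)"
      using inner by metis
  qed (rule prob)
  then show ?thesis unfolding \<mu>_def P_def N_def p_def diag_spectral_measure_def .
qed

text \<open>If \<open>W\<close> diagonalises \<open>U\<close>, then \<open>Q * W\<close>
  diagonalises the conjugate with the same \<open>d\<close>. As the adjoint of \<open>Q\<close>
  fixes \<open>e\<close>, the coordinates of \<open>e\<close> agree as well, so both spectral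
  measures are the same term.\<close>

lemma spectral_measure_conj:
  assumes U: "unitary_mat n U" and Q: "unitary_mat n Q"
    and e: "e \<in> carrier_vec n" "e \<bullet>c e = 1" "Q *\<^sub>v e = e"
  obtains \<mu> where "spectral_measure n U e \<mu>" "spectral_measure n (Q * U * mat_adjoint Q) e \<mu>"
proof -
  obtain W d where W: "unitary_mat n W" and Ueq: "U = W * mat_diag n d * mat_adjoint W"
    and d: "\<And>i. i < n \<Longrightarrow> cmod (d i) = 1"
    using unitary_mat_diagonalizable[OF U] by metis
  note Qc = unitary_matD[OF Q] and Wc = unitary_matD[OF W]
  have QW: "unitary_mat n (Q * W)" by (rule unitary_mat_mult[OF Q W])
  have "mat_adjoint Q *\<^sub>v (Q *\<^sub>v e) = e"
    unfolding assoc_mult_mat_vec[OF Qc(2,1) e(1), symmetric] Qc(4) using e by simp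
  then have "mat_adjoint Q *\<^sub>v e = e" unfolding e(3) .
  then have p: "mat_adjoint (Q * W) *\<^sub>v e = mat_adjoint W *\<^sub>v e"
    unfolding mat_adjoint_mult[OF Qc(1) Wc(1)] assoc_mult_mat_vec[OF Wc(2) Qc(2) e(1)] by simp
  have V: "Q * U * mat_adjoint Q = (Q * W) * mat_diag n d * mat_adjoint (Q * W)"
    unfolding Ueq by (rule conj_conj[OF Qc(1) Wc(1)]) simp
  show thesis
  proof (rule that)
    show "spectral_measure n U e (diag_spectral_measure n d (mat_adjoint W *\<^sub>v e))"
      unfolding Ueq by (rule spectral_measure_diag[OF W d e(1,2)])
    show "spectral_measure n (Q * U * mat_adjoint Q) e (diag_spectral_measure n d (mat_adjoint W *\<^sub>v e))"
      unfolding V p[symmetric] by (rule spectral_measure_diag[OF QW d e(1,2)])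
  qed
qed

section \<open>Reduction to CMV shape\<close>

text \<open>Indices start at 0. Coordinate \<open>m\<close> of the CMV basis arises from column \<open>m - 2\<close> of
  \<open>U\<close> for odd \<open>m\<close>, and of its adjoint for even \<open>m\<close>; truncated subtraction sends \<open>m = 1\<close> to
  column 0, as it should.\<close>

definition par :: "complex mat \<Rightarrow> nat \<Rightarrow> complex mat" where
  "par A m = (if odd m then A else mat_adjoint A)"

text \<open>Only pivots are recorded; since the other zeros follow from unitarity, a conjugation has
  nothing else to preserve.\<close>

definition cmv_upto :: "nat \<Rightarrow> complex mat \<Rightarrow> nat \<Rightarrow> bool" where
  "cmv_upto n A m \<longleftrightarrow> (\<forall>k. 1 \<le> k \<longrightarrow> k < m \<longrightarrow> k < n \<longrightarrow> pivot_at n (par A k) k (k - 2))"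

lemma par_cong: "even k = even l \<Longrightarrow> par A k = par A l"
  unfolding par_def by simp

lemma unitary_par: "unitary_mat n A \<Longrightarrow> unitary_mat n (par A m)"
  unfolding par_def using unitary_mat_adjoint by simp

lemma par_conj:
  "R \<in> carrier_mat n n \<Longrightarrow> A \<in> carrier_mat n n \<Longrightarrow>
    par (R * A * mat_adjoint R) m = R * par A m * mat_adjoint R"
  unfolding par_def using mat_adjoint_conj by simp

section \<open>Zero pattern of a partially reduced matrix\<close>

lemma index_par_Suc:
  assumes "A \<in> carrier_mat n n" "i < n" "j < n"
  shows "par A (Suc m) $$ (i, j) = cnj (par A m $$ (j, i))"
  using assms by (auto simp: par_def index_mat_adjoint)

lemma cmv_uptoD:
  "cmv_upto n A m \<Longrightarrow> 1 \<le> k \<Longrightarrow> k < m \<Longrightarrow> k < n \<Longrightarrow> pivot_at n (par A k) k (k - 2)"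
  unfolding cmv_upto_def by blast

text \<open>In \<open>par A j\<close>, a column \<open>l\<close> of the parity of \<open>j\<close>
  was treated directly and has its pivot in row \<open>l + 2\<close>. Columns of the other parity
  end one row earlier, by \<open>cmv_upto_zero'\<close>.\<close>

lemma cmv_upto_zero:
  assumes S: "cmv_upto n A m" and "Suc (Suc l) < m" "Suc (Suc l) < k" "k < n" "even j = even l"
  shows "par A j $$ (k, l) = 0"
proof -
  have "par A j = par A (Suc (Suc l))" using assms(5) by (intro par_cong) simp
  then show ?thesis
    using cmv_uptoD[OF S, of "Suc (Suc l)"] assms(2-4) unfolding pivot_at_def by simp
qed

text \<open>The zeros that no reflection creates: by induction, row \<open>l\<close> is the only one in which
  columns \<open>l - 2\<close> and \<open>k\<close> of \<open>par A l\<close> can both be nonzero, so their orthogonality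
  annihilates the entry \<open>(l, k)\<close>.\<close>

lemma cmv_upto_zero':
  assumes A: "unitary_mat n A" and S: "cmv_upto n A m"
  shows "Suc l < m \<Longrightarrow> Suc l < k \<Longrightarrow> k < n \<Longrightarrow> even j \<noteq> even l \<Longrightarrow> par A j $$ (k, l) = 0"
proof (induction l arbitrary: j k rule: less_induct)
  case (less l)
  note Ac = unitary_matD(1)[OF A]
  have pj: "par A j = par A (Suc l)" using less.prems by (intro par_cong) simp
  show ?case
  proof (cases "l = 0")
    \<comment> \<open>Column 0 is special: step 1 placed its pivot in row 1, since
      \<open>1 - 2 = 0\<close>.\<close>
    case True
    then show ?thesis
      using cmv_uptoD[OF S, of 1] less.prems unfolding pj pivot_at_def by simp
  next
    case False
    define c where "c = l - 2"
    have piv: "pivot_at n (par A l) l c"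
      using cmv_uptoD[OF S, of l] less.prems False unfolding c_def by simp
    have "par A l $$ (l, k) = 0"
    proof (rule unitary_mat_pivot[OF unitary_par[OF A]])
      show "l < n" "c < n" "k < n" "c \<noteq> k" using less.prems unfolding c_def by auto
      show "par A l $$ (l, c) \<noteq> 0" using piv pos_real_nonzero unfolding pivot_at_def by blast
      fix i assume i: "i < n" "i \<noteq> l"
      show "par A l $$ (i, c) = 0 \<or> par A l $$ (i, k) = 0"
      proof (cases "l < i")
        case True
        then show ?thesis using piv i unfolding pivot_at_def by blast
      next
        case False
        then have il: "i < l" using i by simp
        \<comment> \<open>Above the pivot row it is column \<open>k\<close> that vanishes, read in
          the adjoint as row \<open>k\<close>. The induction hypothesis covers the \<open>i\<close>
          of the parity of \<open>l\<close>, and \<open>cmv_upto_zero\<close> the others.\<close>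
        have "par A (Suc l) $$ (k, i) = 0"
        proof (cases "even i = even l")
          case True
          then show ?thesis using less.IH[OF il, of k "Suc l"] il less.prems by simp
        next
          case False
          then show ?thesis
            using il less.prems by (intro cmv_upto_zero[OF S]) auto
        qed
        then have "par A l $$ (i, k) = 0"
          using index_par_Suc[OF Ac, of k i l] i less.prems by simp
        then show ?thesis ..
      qed
    qed
    then show ?thesis
      unfolding pj using index_par_Suc[OF Ac, of k l l] less.prems by simp
  qed
qed

text \<open>Used in contrapositive form: a nonzero entry anywhere in the lower left block guarantees
  that the column to be treated at step \<open>m\<close> has something to reflect.\<close>

lemma cmv_upto_invariant_block:
  assumes A: "unitary_mat n A" and S: "cmv_upto n A m" and m: "1 \<le> m" "m < n"
    and tail: "\<And>k. m \<le> k \<Longrightarrow> k < n \<Longrightarrow> par A m $$ (k, m - 2) = 0"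
    and i: "i < m" "m \<le> k" "k < n"
  shows "A $$ (k, i) = 0"
proof -
  note Ac = unitary_matD(1)[OF A]
  have early: "par A m $$ (k, i) = 0" if "Suc i < m" "m \<le> k" "k < n" for i k
  proof (cases "even i = even m")
    case True
    show ?thesis
    proof (cases "Suc (Suc i) = m")
      case True
      then have "i = m - 2" by simp
      then show ?thesis using tail that by simp
    next
      case False
      then show ?thesis using True that by (intro cmv_upto_zero[OF S]) auto
    qed
  next
    case False
    then show ?thesis using that by (intro cmv_upto_zero'[OF A S]) auto
  qed
  have last: "par A m $$ (k, m - 1) = 0" if k: "m \<le> k" "k < n" for k
  proof (cases "m = 1")
    case True
    then show ?thesis using tail k by simp
  next
    case False
    \<comment> \<open>Column \<open>m - 1\<close> is just out of reach of
      \<open>cmv_upto_zero'\<close>, which needs \<open>Suc l < m\<close>. The same orthogonality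
      argument works, with \<open>early\<close> in place of the induction hypothesis.\<close>
    define l where "l = m - 1"
    have l: "m = Suc l" "1 \<le> l" using m False unfolding l_def by auto
    have piv: "pivot_at n (par A l) l (l - 2)"
      using cmv_uptoD[OF S, of l] l m by simp
    have "par A l $$ (l, k) = 0"
    proof (rule unitary_mat_pivot[OF unitary_par[OF A]])
      show "l < n" "l - 2 < n" "k < n" "l - 2 \<noteq> k" using l m k by auto
      show "par A l $$ (l, l - 2) \<noteq> 0" using piv pos_real_nonzero unfolding pivot_at_def by blast
      fix i assume i: "i < n" "i \<noteq> l"
      show "par A l $$ (i, l - 2) = 0 \<or> par A l $$ (i, k) = 0"
      proof (cases "l < i")
        case True
        then show ?thesis using piv i unfolding pivot_at_def by blast
      next
        case False
        then have "par A (Suc l) $$ (k, i) = 0" using early[of i k] i k l by simp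
        then show ?thesis using index_par_Suc[OF Ac, of k i l] i k by simp
      qed
    qed
    then show ?thesis
      using index_par_Suc[OF Ac, of k l l] k l by simp
  qed
  have block: "par A m $$ (k, i) = 0" if "i < m" "m \<le> k" "k < n" for i k
    using early[of i k] last[of k] that by (cases "Suc i = m") auto
  show ?thesis
  proof (cases "odd m")
    case True
    then show ?thesis using block[OF i] unfolding par_def by simp
  next
    \<comment> \<open>For even \<open>m\<close> the zero block belongs to the adjoint, so it is the
      upper right block of \<open>A\<close> that vanishes; \<open>unitary_mat_block\<close> passes
      to the lower left one.\<close>
    case False
    have "par A m $$ (i, k) = 0"
      using unitary_mat_block[OF unitary_par[OF A, of m] _ block i] m by simp
    then show ?thesis using False i index_mat_adjoint[OF Ac, of i k] unfolding par_def by simp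
  qed
qed

text \<open>Otherwise the preimage under \<open>Q\<close> of the span of e_0, ..., e_(m-1) would be
  a proper \<open>U\<close>-invariant subspace containing e_0, and hence the whole orbit of
  e_0.\<close>

lemma cyclic_vec_no_invariant_block:
  assumes cyc: "cyclic_vec n U (unit_vec n 0)" and U: "U \<in> carrier_mat n n"
    and Q: "unitary_mat n Q" "Q *\<^sub>v unit_vec n 0 = unit_vec n 0" and m: "1 \<le> m" "m < n"
  obtains i k where "i < m" "m \<le> k" "k < n" "(Q * U * mat_adjoint Q) $$ (k, i) \<noteq> 0"
proof (rule ccontr)
  assume neg: "\<not> thesis"
  note entry = that
  note Qc = unitary_matD[OF Q(1)]
  define B where "B = Q * U * mat_adjoint Q"
  have Bc: "B \<in> carrier_mat n n" unfolding B_def using Qc U by simp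
  have z: "B $$ (k, i) = 0" if "i < m" "m \<le> k" "k < n" for i k
    using that entry neg unfolding B_def by blast
  have BQ: "B * Q = Q * U"
  proof -
    have "B * Q = Q * U * (mat_adjoint Q * Q)"
      unfolding B_def by (rule assoc_mult_mat[OF mult_carrier_mat[OF Qc(1) U] Qc(2,1)])
    then show ?thesis unfolding Qc(4) using right_mult_one_mat[OF mult_carrier_mat[OF Qc(1) U]] by simp
  qed
  define S where "S = {x \<in> carrier_vec n. \<forall>k. m \<le> k \<longrightarrow> k < n \<longrightarrow> (Q *\<^sub>v x) $ k = 0}"
  have e0: "unit_vec n 0 \<in> S" unfolding S_def using Q(2) m by simp
  have step: "U *\<^sub>v x \<in> S" if x: "x \<in> S" for x
  proof -
    have xc: "x \<in> carrier_vec n" and xz: "\<And>k. m \<le> k \<Longrightarrow> k < n \<Longrightarrow> (Q *\<^sub>v x) $ k = 0"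
      using x unfolding S_def by auto
    have Qx: "Q *\<^sub>v x \<in> carrier_vec n" by (rule mult_mat_vec_carrier[OF Qc(1) xc])
    have eq: "Q *\<^sub>v (U *\<^sub>v x) = B *\<^sub>v (Q *\<^sub>v x)"
      unfolding assoc_mult_mat_vec[OF Qc(1) U xc, symmetric] assoc_mult_mat_vec[OF Bc Qc(1) xc, symmetric]
        BQ ..
    have "(B *\<^sub>v (Q *\<^sub>v x)) $ k = 0" if "m \<le> k" "k < n" for k
      unfolding index_mult_mat_vec_sum[OF Bc Qx that(2)]
    proof (rule sum.neutral, intro ballI)
      fix j assume "j \<in> {..<n}"
      then show "B $$ (k, j) * (Q *\<^sub>v x) $ j = 0"
        using z[of j k] xz[of j] that by (cases "j < m") (auto simp del: index_mult_mat_vec)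
    qed
    then show ?thesis unfolding S_def eq[symmetric] using U xc by simp
  qed
  \<comment> \<open>Powers unfold as \<open>U ^\<^sub>m k * U\<close>, so the vector changes in the
    induction and has to be arbitrary.\<close>
  have pow: "U ^\<^sub>m k *\<^sub>v x \<in> S" if "x \<in> S" for k x
    using that
  proof (induction k arbitrary: x)
    case 0
    then have "x \<in> carrier_vec n" unfolding S_def by simp
    then show ?case using 0 U by simp
  next
    case (Suc k)
    have "x \<in> carrier_vec n" using Suc.prems unfolding S_def by simp
    then have "U ^\<^sub>m Suc k *\<^sub>v x = U ^\<^sub>m k *\<^sub>v (U *\<^sub>v x)"
      using assoc_mult_mat_vec[OF pow_carrier_mat[OF U] U] by simp
    then show ?case using Suc.IH[OF step[OF Suc.prems]] by simp
  qed
  interpret V: vec_space "TYPE(complex)" n .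
  have "submodule class_ring S (module_vec TYPE(complex) n)"
  proof
    show "S \<subseteq> carrier (module_vec TYPE(complex) n)" unfolding S_def by (auto simp: module_vec_simps)
    show "\<zero>\<^bsub>module_vec TYPE(complex) n\<^esub> \<in> S" 
      unfolding S_def module_vec_simps using Qc(1) by auto
    fix v w assume "v \<in> S" "w \<in> S"
    then show "v \<oplus>\<^bsub>module_vec TYPE(complex) n\<^esub> w \<in> S"
      unfolding S_def module_vec_simps using mult_add_distrib_mat_vec[OF Qc(1), of v w] Qc(1)
      by (auto simp del: index_mult_mat_vec)
  next
    fix c :: complex and v assume "v \<in> S"
    then show "c \<odot>\<^bsub>module_vec TYPE(complex) n\<^esub> v \<in> S"
      unfolding S_def module_vec_simps using mult_mat_vec[OF Qc(1), of v c] Qc(1) by auto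
  qed
  then have "V.span (range (\<lambda>k. (U ^\<^sub>m k) *\<^sub>v unit_vec n 0)) \<subseteq> S"
    using pow[OF e0] by (intro V.span_is_subset) auto
  then have "carrier_vec n \<subseteq> S" using cyc unfolding cyclic_vec_def by simp
  \<comment> \<open>The preimage of e_m shows that \<open>S\<close> is proper.\<close>
  moreover have "mat_adjoint Q *\<^sub>v unit_vec n m \<in> carrier_vec n"
    by (rule mult_mat_vec_carrier[OF Qc(2)]) simp
  ultimately have "(Q *\<^sub>v (mat_adjoint Q *\<^sub>v unit_vec n m)) $ m = 0" using m unfolding S_def by blast
  then show False
    unfolding assoc_mult_mat_vec[OF Qc(1,2) unit_vec_carrier, symmetric] Qc(3) using m by simp
qed

section \<open>The induction over the steps and the final shape\<close>

lemma conj_by_snoc: "conj_by (Rs @ [R]) U = R * conj_by Rs U * mat_adjoint R"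
  unfolding conj_by_def by simp

text \<open>The accumulated product \<open>Q\<close> is kept beside the list because both cyclicity
  and the spectral measure use a single unitary matrix that fixes e_0.\<close>

lemma householder_reduction:
  assumes U: "unitary_mat n U" and cyc: "cyclic_vec n U (unit_vec n 0)"
  shows "m < n \<Longrightarrow> \<exists>Rs Q. (\<forall>R \<in> set Rs. householder n R) \<and> unitary_mat n Q \<and>
    Q *\<^sub>v unit_vec n 0 = unit_vec n 0 \<and> conj_by Rs U = Q * U * mat_adjoint Q \<and>
    cmv_upto n (conj_by Rs U) (Suc m)"
proof (induction m)
  case 0
  have "conj_by [] U = 1\<^sub>m n * U * mat_adjoint (1\<^sub>m n)"
    using unitary_matD[OF unitary_mat_one, of n] unitary_matD(1)[OF U] unfolding conj_by_def
    by (metis fold_simps(1) left_mult_one_mat right_mult_one_mat)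
  then show ?case
    using unitary_mat_one by (intro exI[of _ "[]"] exI[of _ "1\<^sub>m n"]) (auto simp: cmv_upto_def)
next
  case (Suc l)
  define m where "m = Suc l"
  have m: "1 \<le> m" "m < n" using Suc.prems unfolding m_def by auto
  obtain Rs Q where Rs: "\<forall>R \<in> set Rs. householder n R" and Q: "unitary_mat n Q"
    and Qe: "Q *\<^sub>v unit_vec n 0 = unit_vec n 0" and eq: "conj_by Rs U = Q * U * mat_adjoint Q"
    and S: "cmv_upto n (conj_by Rs U) m"
    using Suc unfolding m_def by auto
  note Uc = unitary_matD(1)[OF U] and Qc = unitary_matD(1)[OF Q]
  define A where "A = conj_by Rs U"
  have A: "unitary_mat n A" unfolding A_def eq by (rule unitary_mat_conj[OF Q U])
  note Ac = unitary_matD(1)[OF A]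
  note S = S[folded A_def]
  obtain i k where "i < m" "m \<le> k" "k < n" "A $$ (k, i) \<noteq> 0"
    using cyclic_vec_no_invariant_block[OF cyc Uc Q Qe m] unfolding A_def eq by blast
  then obtain k where k: "m \<le> k" "k < n" "par A m $$ (k, m - 2) \<noteq> 0"
    using cmv_upto_invariant_block[OF A S m] by blast
  obtain R where R: "householder n R" and Rh: "fixes_head n m R"
    and piv: "pivot_at n (R * par A m * mat_adjoint R) m (m - 2)"
    by (rule pivot_at_create[OF unitary_matD(1)[OF unitary_par[OF A]] _ k]) (use m in auto)
  note Ru = fixes_headD(1)[OF Rh]
  note Rc = unitary_matD(1)[OF Ru]
  have snoc: "conj_by (Rs @ [R]) U = R * A * mat_adjoint R" unfolding conj_by_snoc A_def ..
  \<comment> \<open>\<open>R\<close> was chosen for \<open>par A m\<close>, possibly the adjoint; by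
    \<open>par_conj\<close> the same conjugation acts on \<open>A\<close> and on its
    adjoint.\<close>
  have "cmv_upto n (R * A * mat_adjoint R) (Suc m)"
    unfolding cmv_upto_def par_conj[OF Rc Ac]
  proof (intro allI impI)
    fix j assume j: "1 \<le> j" "j < Suc m" "j < n"
    show "pivot_at n (R * par A j * mat_adjoint R) j (j - 2)"
    proof (cases "j = m")
      case True
      then show ?thesis using piv by simp
    next
      case False
      then show ?thesis
        using j m by (intro pivot_at_conj[OF Rh unitary_matD(1)[OF unitary_par[OF A]]] cmv_uptoD[OF S]) auto
    qed
  qed
  moreover have "R * A * mat_adjoint R = (R * Q) * U * mat_adjoint (R * Q)"
    unfolding A_def eq by (rule conj_conj[OF Rc Qc Uc])
  moreover have "R * Q *\<^sub>v unit_vec n 0 = unit_vec n 0"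
    unfolding assoc_mult_mat_vec[OF Rc Qc unit_vec_carrier] Qe
    by (rule fixes_head_unit_vec[OF Rh]) (use m in auto)
  ultimately show ?case
    unfolding m_def[symmetric]
    using Rs R unitary_mat_mult[OF Ru Q] snoc
    by (intro exI[of _ "Rs @ [R]"] exI[of _ "R * Q"]) auto
qed

text \<open>Zeros to the left of the band are read off the columns of \<open>A\<close>, those to the
  right off the columns of its adjoint.\<close>

lemma CMV_shapeI:
  assumes A: "unitary_mat n A" and S: "cmv_upto n A n"
  shows "CMV_shape n A"
proof -
  note Ac = unitary_matD(1)[OF A]
  have adj: "A $$ (i, j) = cnj (par A 0 $$ (j, i))" if "i < n" "j < n" for i j
    using index_par_Suc[OF Ac that, of 0] by (simp add: par_def)
  have A1: "A = par A 1" by (simp add: par_def)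
  have zero: "entry A k l = 0"
    if k: "k \<in> {2 * j + 1, 2 * j + 2} \<inter> {1..n}" and l: "l \<in> {1..n}"
      and out: "\<not> (2 * j \<le> l \<and> l \<le> 2 * j + 3)" for j k l
  proof -
    define a b where "a = k - 1" and "b = l - 1"
    have ab: "a < n" "b < n" and a: "a = 2 * j \<or> a = 2 * j + 1" and kl: "k = Suc a" "l = Suc b"
      using k l unfolding a_def b_def by auto
    have "A $$ (a, b) = 0"
    proof (cases "l < 2 * j")
      case True
      then have b: "Suc b < 2 * j" using kl by simp
      show ?thesis
      proof (cases "even b")
        case True
        then have "par A 1 $$ (a, b) = 0"
          using b a ab by (intro cmv_upto_zero'[OF A S]) auto
        then show ?thesis using A1 by simp
      next
        case False
        \<comment> \<open>An odd column may reach down to row \<open>b + 2\<close>; parity keeps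
          this strictly above row \<open>2 * j\<close>.\<close>
        then have "Suc (Suc b) \<noteq> 2 * j" by presburger
        then have "par A 1 $$ (a, b) = 0"
          using False b a ab by (intro cmv_upto_zero[OF S]) auto
        then show ?thesis using A1 by simp
      qed
    next
      case False
      then have b: "2 * j + 3 \<le> b" using out kl by simp
      \<comment> \<open>In the adjoint, column \<open>2 * j\<close> ends two rows and column
        \<open>2 * j + 1\<close> one row below the diagonal, so both end at row
        \<open>2 * j + 2\<close> at the latest.\<close>
      have "par A 0 $$ (b, a) = 0"
        using a
      proof
        assume "a = 2 * j"
        then show ?thesis using b ab by (intro cmv_upto_zero[OF S]) auto
      next
        assume "a = 2 * j + 1"
        then show ?thesis using b ab by (intro cmv_upto_zero'[OF A S]) auto
      qed
      then show ?thesis using adj[OF ab] by simp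
    qed
    then show ?thesis unfolding kl by simp
  qed
  have pos: "pos_real (par A i $$ (i, i - 2))" if "1 \<le> i" "i < n" for i
    using cmv_uptoD[OF S that(1,2,2)] unfolding pivot_at_def by blast
  have "pos_real (entry A 2 1)" if "2 \<le> n"
    using pos[of 1] that by (simp add: par_def)
  moreover have "pos_real (entry A (2 * j - 1) (2 * j + 1))" if "1 \<le> j" "2 * j + 1 \<le> n" for j
  proof -
    \<comment> \<open>Counted from 0 this is entry \<open>(2 * j - 2, 2 * j)\<close> of
      \<open>A\<close>, the conjugate of a pivot of the adjoint.\<close>
    have "pos_real (par A (2 * j) $$ (2 * j, 2 * j - 2))" using pos[of "2 * j"] that by simp
    moreover have "par A (2 * j) = par A 0" by (rule par_cong) simp
    ultimately show ?thesis
      using adj[of "2 * j - 2" "2 * j"] that by (simp add: pos_real_cnj numeral_2_eq_2)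
  qed
  moreover have "pos_real (entry A (2 * j + 2) (2 * j))" if "1 \<le> j" "2 * j + 2 \<le> n" for j
    using pos[of "2 * j + 1"] that by (simp add: par_def)
  ultimately show ?thesis unfolding CMV_shape_def using Ac zero by blast
qed

theorem theorem3p2:
  fixes n :: nat and U :: "complex mat"
  assumes "n \<ge> 1"
    and "unitary_mat n U"
    and "cyclic_vec n U (unit_vec n 0)"
  shows "\<exists>Rs. (\<forall>R \<in> set Rs. householder n R) \<and> CMV_shape n (conj_by Rs U) \<and>
           (\<exists>\<mu>. spectral_measure n U (unit_vec n 0) \<mu> \<and>
                spectral_measure n (conj_by Rs U) (unit_vec n 0) \<mu>)"
proof -
  \<comment> \<open>The last step is number \<open>n - 1\<close>; for \<open>n = 1\<close> no
    reflection is applied.\<close>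
  obtain Rs Q where Rs: "\<forall>R \<in> set Rs. householder n R" and Q: "unitary_mat n Q"
    and Qe: "Q *\<^sub>v unit_vec n 0 = unit_vec n 0" and eq: "conj_by Rs U = Q * U * mat_adjoint Q"
    and S: "cmv_upto n (conj_by Rs U) (Suc (n - 1))"
    using householder_reduction[OF assms(2,3), of "n - 1"] assms(1) by auto
  have "unitary_mat n (conj_by Rs U)" unfolding eq by (rule unitary_mat_conj[OF Q assms(2)])
  then have "CMV_shape n (conj_by Rs U)" using CMV_shapeI S assms(1) by simp
  moreover have "(unit_vec n 0 :: complex Matrix.vec) \<bullet>c unit_vec n 0 = 1"
    using cscalar_prod_self[of "unit_vec n 0 :: complex Matrix.vec" n] assms(1)
    by (simp add: if_distrib[of cmod] if_distrib[of "\<lambda>x. x ^ 2"] cong: if_cong)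
  then obtain \<mu> where "spectral_measure n U (unit_vec n 0) \<mu>"
      "spectral_measure n (conj_by Rs U) (unit_vec n 0) \<mu>"
    unfolding eq by (rule spectral_measure_conj[OF assms(2) Q unit_vec_carrier _ Qe])
  ultimately show ?thesis using Rs by blast
qed

end
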